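(* For $T>0$ let $g(T)=\frac{1}{T}J^*_\lambda(0,T)$. Let $T'$ be a strict local maximizer of $g$ on $(0,\infty)$. Then $T'$ is the strict global maximizer of $g$ on $(0,\infty)$.
   Context: "Increasing" and "decreasing" are meant in the weak sense throughout. Model. A system has deterioration level in $\mathscr{X}=\{0,1,\ldots,\xi\}$, where $\xi\in\mathbb{N}$ is the failure level. The decision maker continuously chooses a production rate $s\in\mathscr{S}=[0,\bar s]$, $0<\bar s<\infty$. Under rate $s$, revenue accrues at rate $r(s)$ and the deterioration level jumps up by one according to a Poisson process with instantaneous intensity $\lambda f(s)$, where $\lambda\ge 0$ is the (fixed, known) base rate. The deterioration function $f:\mathscr{S}\to\mathbb{R}_+$ and the revenue function $r:\mathscr{S}\to\mathbb{R}$ are continuous and increasing, with $f(0)=0$ and $r(0)\le 0$. The maintenance cost function $c_m:\mathscr{X}\to\mathbb{R}_+$ is increasing and convex. Time is indexed backwards: $t$ denotes the remaining time to the planned maintenance moment, which occurs at $t=0$, and $X_k$ is the deterioration level when $k$ time units remain. $\mathscr{U}$ is the set of non-anticipating production policies under which, almost surely, the deterioration level never exceeds $\xi$; in particular, the system is turned off ($s=0$) once it has reached level $\xi$. For $u\in\mathscr{U}$, with induced production rate $s^u_\lambda(x,k)$ at level $x$ and remaining time $k$, $$J^u_\lambda(x,t)=\mathbb{E}_u\Big[\int_0^t r\big(s^u_\lambda(X_k,k)\big)\,dk-c_m(X_0)\ \Big|\ X_t=x\Big],\qquad J^*_\lambda(x,t)=\sup_{u\in\mathscr{U}}J^u_\lambda(x,t).$$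 Thus $g(T)$ is the average profit per time unit when maintenance is planned every $T$ time units (each interval starting with a new system at deterioration level $0$) and an optimal production policy is followed in between. *)

theory Defs
  imports "HOL-Probability.Probability"
begin

text \<open>
  Processes are indexed by elapsed time \<open>\<tau> \<in> [0, t]\<close>, where \<open>t\<close> is the time that remains until the
  planned maintenance when the system is first observed; the remaining time is \<open>k = t - \<tau>\<close>.  The
  level written \<open>X\<^sub>k\<close> in backward time is therefore \<open>X (t - k)\<close> here: the initial level, with \<open>t\<close> time
  units remaining, is \<open>X 0\<close>, and the level at maintenance is \<open>X t\<close>.
\<close>

definition predictable_sigma :: "real \<Rightarrow> 'w set \<Rightarrow> (real \<Rightarrow> 'w measure) \<Rightarrow> (real \<times> 'w) measure" where
  "predictable_sigma t \<Omega> F = sigma ({0..t} \<times> \<Omega>)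
     ({{0} \<times> A |A. A \<in> sets (F 0)} \<union>
      {{a<..b} \<times> A |a b A. 0 \<le> a \<and> a \<le> b \<and> b \<le> t \<and> A \<in> sets (F a)})"

text \<open>
  The type \<^typ>\<open>nat\<close> carries the discrete topology, so one-sided limits of level paths are values that
  are eventually attained.
\<close>

definition unit_jump_path :: "real \<Rightarrow> (real \<Rightarrow> nat) \<Rightarrow> bool" where
  "unit_jump_path t p \<longleftrightarrow>
     mono_on {0..t} p \<and>
     (\<forall>\<tau>\<in>{0..<t}. continuous (at_right \<tau>) p) \<and>
     (\<forall>\<tau>\<in>{0<..t}. \<exists>l. (p \<longlongrightarrow> l) (at_left \<tau>) \<and> (p \<tau> = l \<or> p \<tau> = l + 1))"

definition jump_times :: "real \<Rightarrow> (real \<Rightarrow> nat) \<Rightarrow> real set" where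
  "jump_times t p = {\<tau>\<in>{0<..t}. \<not> continuous (at_left \<tau>) p}"

text \<open>
  One realisation of an admissible production policy over a horizon of length \<open>t\<close>, started at level \<open>x\<close>:
  \<open>s \<tau>\<close> is the production rate in force and \<open>X \<tau>\<close> the deterioration level, on a probability space
  with information flow \<open>F\<close>.  The rate may depend on the whole observed history and on
  additional randomisation; feedback rates \<open>s \<tau> \<omega> = \<sigma> (X \<tau> \<omega>) (t - \<tau>)\<close> are a special case.
  Assumption \<open>intensity\<close> is the definition of the stochastic \<open>F\<close>-intensity of a
  point process (Bremaud): it says that the jumps of \<open>X\<close> occur with instantaneous intensity
  \<open>lam * f (s \<tau>)\<close> given \<open>F\<close>, which also excludes that \<open>F\<close> anticipates future jumps.
\<close>

locale controlled_system =
  prob_space M + filtration "space M" F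
  for M :: "'w measure" and F :: "real \<Rightarrow> 'w measure" +
  fixes \<xi> :: nat and smax :: real and f :: "real \<Rightarrow> real" and lam :: real
    and x :: nat and t :: real
    and s :: "real \<Rightarrow> 'w \<Rightarrow> real" and X :: "real \<Rightarrow> 'w \<Rightarrow> nat"
  assumes subalgebra: "\<And>\<tau>. subalgebra M (F \<tau>)"
    and rate_range: "\<And>\<tau> \<omega>. \<tau> \<in> {0..t} \<Longrightarrow> \<omega> \<in> space M \<Longrightarrow> s \<tau> \<omega> \<in> {0..smax}"
    and rate_progressive: "\<And>b. b \<in> {0..t} \<Longrightarrow>
      (\<lambda>(\<tau>, \<omega>). s \<tau> \<omega>) \<in> borel_measurable (restrict_space borel {0..b} \<Otimes>\<^sub>M F b)"
    and level_adapted: "\<And>\<tau>. \<tau> \<in> {0..t} \<Longrightarrow> X \<tau> \<in> measurable (F \<tau>) (count_space UNIV)"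
    and level_initial: "AE \<omega> in M. X 0 \<omega> = x"
    and level_paths: "AE \<omega> in M. unit_jump_path t (\<lambda>\<tau>. X \<tau> \<omega>)"
    and intensity: "\<And>C :: real \<times> 'w \<Rightarrow> ennreal.
      C \<in> borel_measurable (predictable_sigma t (space M) F) \<Longrightarrow>
      (\<integral>\<^sup>+ \<omega>. (\<Sum>\<tau>\<in>jump_times t (\<lambda>\<tau>. X \<tau> \<omega>). C (\<tau>, \<omega>)) \<partial>M) =
      (\<integral>\<^sup>+ \<omega>. (\<integral>\<^sup>+ \<tau>\<in>{0..t}. C (\<tau>, \<omega>) * ennreal (lam * f (s \<tau> \<omega>)) \<partial>lborel) \<partial>M)"
    and level_bounded: "AE \<omega> in M. \<forall>\<tau>\<in>{0..t}. X \<tau> \<omega> \<le> \<xi>"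
    and off_at_failure: "AE \<omega> in M. \<forall>\<tau>\<in>{0..t}. X \<tau> \<omega> = \<xi> \<longrightarrow> s \<tau> \<omega> = 0"

definition expected_profit ::
  "(real \<Rightarrow> real) \<Rightarrow> (nat \<Rightarrow> real) \<Rightarrow> real \<Rightarrow> 'w measure \<Rightarrow> (real \<Rightarrow> 'w \<Rightarrow> real) \<Rightarrow> (real \<Rightarrow> 'w \<Rightarrow> nat) \<Rightarrow> real" where
  "expected_profit r c t M s X =
     (\<integral>\<omega>. (LINT \<tau>:{0..t}|lborel. r (s \<tau> \<omega>)) - c (X t \<omega>) \<partial>M)"

text \<open>
  Each policy induces its own probability law, so the supremum ranges over filtered probability
  spaces as well.  Since one cannot quantify over types, the sample points are taken in
  \<^typ>\<open>nat \<Rightarrow> real\<close>, which is rich enough to carry every standard Borel space, in particular the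
  sequence of jump times together with independent randomisation.
\<close>

definition optimal_profit ::
  "nat \<Rightarrow> real \<Rightarrow> (real \<Rightarrow> real) \<Rightarrow> (real \<Rightarrow> real) \<Rightarrow> (nat \<Rightarrow> real) \<Rightarrow> real \<Rightarrow> nat \<Rightarrow> real \<Rightarrow> real" where
  "optimal_profit \<xi> smax f r c lam x t =
     Sup {expected_profit r c t M s X |(M :: (nat \<Rightarrow> real) measure) F s X.
            controlled_system M F \<xi> smax f lam x t s X}"

definition average_profit ::
  "nat \<Rightarrow> real \<Rightarrow> (real \<Rightarrow> real) \<Rightarrow> (real \<Rightarrow> real) \<Rightarrow> (nat \<Rightarrow> real) \<Rightarrow> real \<Rightarrow> real \<Rightarrow> real" where
  "average_profit \<xi> smax f r c lam T = 1 / T * optimal_profit \<xi> smax f r c lam 0 T"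

end

theory Submission
  imports Defs "HOL-Real_Asymp.Real_Asymp"
begin

text \<open>
  The value function \<open>V\<close> solves the Hamilton-Jacobi-Bellman system
  \<open>V\<^sub>x' = H (V\<^sub>x - V\<^sub>x\<^sub>+\<^sub>1)\<close>, \<open>V\<^sub>x(0) = - c x\<close>, with \<open>H d = max\<^sub>s (r s - \<lambda> f s d)\<close> decreasing.
  Convexity of \<open>c\<close> makes the marginal values \<open>V\<^sub>x - V\<^sub>x\<^sub>+\<^sub>1\<close> increasing in the remaining time, so
  \<open>V\<^sub>0\<close> is concave.  For a concave \<open>J\<close>, any \<open>T\<close> with \<open>J T / T \<ge> J T' / T'\<close> gives the same inequality
  on the whole segment between \<open>T\<close> and \<open>T'\<close>, so a strict local maximum of \<open>J T / T\<close> is global.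
  That \<open>V\<^sub>0\<close> is the optimal profit is a verification argument: integrating the marginal value
  against the jumps of the level and applying the intensity gives
  \<open>profit = V - E (integrated HJB slack)\<close> for every policy, and the slack vanishes for a controlled
  system with the optimal feedback rate, built from independent exponential variables.
\<close>

section \<open>Scalar differential equations\<close>

text \<open>The level is not predictable: at a jump it already has its new value. Since
  \<open>intensity\<close> accepts only predictable nonnegative integrands, the marginal value is
  read at the left limit of the level; its sign comes from the monotonicity of \<open>c\<close> and
  of the marginal values in the remaining time. This single use of \<open>intensity\<close>,
  together with a pathwise change of variables for step paths, takes the place of martingale
  calculus. Attainment is the harder half: a concrete filtered space has to satisfy
  \<open>intensity\<close> for every predictable integrand. Independence reduces this to one
  exponential variable at a time, where it comes down to the identity P(v > b) = E max(0, v - b) of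
  the unit exponential law. Because time is counted backwards, one solution on a long interval
  serves all shorter horizons. This is what turns concavity of a fixed solution in the remaining
  time into concavity of the optimal profit in the horizon.\<close>

lemma has_integral_exp_mult:
  fixes k :: real assumes "0 \<le> k" "0 < M"
  shows "((\<lambda>u. exp (M * u)) has_integral ((exp (M * k) - 1) / M)) {0..k}"
proof -
  have "((\<lambda>u. exp (M * u)) has_integral (exp (M * k) / M - exp (M * 0) / M)) {0..k}"
    using assms by (intro fundamental_theorem_of_calculus)
      (auto intro!: derivative_eq_intros simp flip: has_real_derivative_iff_has_vector_derivative)
  then show ?thesis by (simp add: diff_divide_distrib)
qed

text \<open>Picard iteration with an exponential weight: for z = exp (- M k) y the integral operator
  contracts on the whole of \<open>{0..T}\<close> at once, so no local solutions have to be
  glued.\<close>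

lemma picard_global:
  fixes F :: "real \<Rightarrow> real \<Rightarrow> real"
  assumes T: "0 \<le> T" and L: "0 \<le> L"
    and cont: "\<And>y. continuous_on {0..T} y \<Longrightarrow> continuous_on {0..T} (\<lambda>k. F k (y k))"
    and lip: "\<And>k y z. k \<in> {0..T} \<Longrightarrow> \<bar>F k y - F k z\<bar> \<le> L * \<bar>y - z\<bar>"
  obtains y where "y 0 = y0"
    "\<And>k. k \<in> {0..T} \<Longrightarrow> (y has_real_derivative F k (y k)) (at k within {0..T})"
proof -
  \<comment> \<open>This gives \<open>L / M \<le> 1/2\<close> and keeps \<open>M\<close> positive
    even for \<open>L = 0\<close>.\<close>
  define M where "M = 2 * L + 1"
  have M: "0 < M" using L by (simp add: M_def)
  \<comment> \<open>The complete space of bounded continuous functions lives on the whole line;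
    clamping the time extends functions from \<open>{0..T}\<close> to it.\<close>
  define cl where "cl k = max 0 (min T k)" for k :: real
  have cl_in: "cl k \<in> {0..T}" for k using T by (auto simp: cl_def)
  have cl_id: "cl k = k" if "k \<in> {0..T}" for k using that by (auto simp: cl_def)
  have cl_cont: "continuous_on UNIV cl" unfolding cl_def by (intro continuous_intros)
  define \<Phi>0 where "\<Phi>0 z k = exp (- M * k) * (y0 + integral {0..k} (\<lambda>u. F u (exp (M * u) * apply_bcontfun z u)))"
    for z :: "real \<Rightarrow>\<^sub>C real" and k
  have Fc: "continuous_on {0..T} (\<lambda>u. F u (exp (M * u) * apply_bcontfun z u))" for z :: "real \<Rightarrow>\<^sub>C real"
    by (rule cont) (intro continuous_intros continuous_on_subset[OF continuous_on_apply_bcontfun], auto)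
  have Fi: "(\<lambda>u. F u (exp (M * u) * apply_bcontfun z u)) integrable_on {0..k}"
    if "k \<in> {0..T}" for z :: "real \<Rightarrow>\<^sub>C real" and k
    by (rule integrable_continuous_interval, rule continuous_on_subset[OF Fc]) (use that in auto)
  have \<Phi>0_cont: "continuous_on {0..T} (\<Phi>0 z)" for z
    unfolding \<Phi>0_def
    by (intro continuous_intros indefinite_integral_continuous_1 Fi) (use T in auto)
  have \<Phi>0_bc: "(\<lambda>k. \<Phi>0 z (cl k)) \<in> bcontfun" for z
  proof -
    have "continuous_on UNIV (\<lambda>k. \<Phi>0 z (cl k))"
      by (rule continuous_on_compose2[OF \<Phi>0_cont cl_cont]) (use cl_in in auto)
    moreover have "bounded (range (\<lambda>k. \<Phi>0 z (cl k)))"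
    proof -
      have "bounded (\<Phi>0 z ` {0..T})"
        by (intro compact_imp_bounded compact_continuous_image \<Phi>0_cont) auto
      then show ?thesis by (rule bounded_subset) (use cl_in in auto)
    qed
    ultimately show ?thesis by (simp add: bcontfun_def)
  qed
  define \<Phi> where "\<Phi> z = Bcontfun (\<lambda>k. \<Phi>0 z (cl k))" for z
  have \<Phi>_apply: "apply_bcontfun (\<Phi> z) k = \<Phi>0 z (cl k)" for z k
    unfolding \<Phi>_def using \<Phi>0_bc by (simp add: Bcontfun_inverse)
  have contr: "dist (\<Phi> z) (\<Phi> z') \<le> 1/2 * dist z z'" for z z'
  proof (rule dist_bound)
    fix k0 :: real
    define k where "k = cl k0"
    have k: "k \<in> {0..T}" using cl_in by (simp add: k_def)
    let ?f = "\<lambda>z u. F u (exp (M * u) * apply_bcontfun z u)"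
    have "\<bar>integral {0..k} (?f z) - integral {0..k} (?f z')\<bar> = \<bar>integral {0..k} (\<lambda>u. ?f z u - ?f z' u)\<bar>"
      using Fi[OF k] by (simp add: integral_diff)
    also have "\<dots> \<le> integral {0..k} (\<lambda>u. L * dist z z' * exp (M * u))"
    proof (rule integral_norm_bound_integral[where 'a=real, unfolded real_norm_def])
      show "(\<lambda>u. ?f z u - ?f z' u) integrable_on {0..k}" using Fi[OF k] by (intro integrable_diff)
      show "(\<lambda>u. L * dist z z' * exp (M * u)) integrable_on {0..k}"
        by (intro integrable_continuous_interval continuous_intros)
      fix u assume u: "u \<in> {0..k}"
      have "\<bar>?f z u - ?f z' u\<bar> \<le> L * \<bar>exp (M * u) * apply_bcontfun z u - exp (M * u) * apply_bcontfun z' u\<bar>"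
        using u k by (intro lip) auto
      also have "\<dots> = L * (exp (M * u) * dist (apply_bcontfun z u) (apply_bcontfun z' u))"
        by (simp add: dist_real_def abs_mult flip: right_diff_distrib)
      also have "\<dots> \<le> L * (exp (M * u) * dist z z')"
        using L by (intro mult_left_mono dist_bounded) auto
      finally show "\<bar>?f z u - ?f z' u\<bar> \<le> L * dist z z' * exp (M * u)" by (simp add: mult_ac)
    qed
    also have "\<dots> = L * dist z z' * ((exp (M * k) - 1) / M)"
      using has_integral_exp_mult[of k M] k M by (simp add: integral_unique)
    also have "\<dots> \<le> L * dist z z' * (exp (M * k) / M)"
      using M L by (intro mult_left_mono divide_right_mono) auto
    finally have "\<bar>integral {0..k} (?f z) - integral {0..k} (?f z')\<bar> \<le> L * dist z z' * (exp (M * k) / M)" .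
    then have "exp (- M * k) * \<bar>integral {0..k} (?f z) - integral {0..k} (?f z')\<bar>
      \<le> exp (- M * k) * (L * dist z z' * (exp (M * k) / M))"
      by (intro mult_left_mono) auto
    also have "\<dots> = L / M * dist z z'" by (simp add: exp_minus)
    also have "\<dots> \<le> 1/2 * dist z z'"
      using L M by (intro mult_right_mono) (auto simp: M_def field_simps)
    finally show "dist (apply_bcontfun (\<Phi> z) k0) (apply_bcontfun (\<Phi> z') k0) \<le> 1/2 * dist z z'"
      by (simp add: \<Phi>_apply \<Phi>0_def dist_real_def abs_mult k_def flip: right_diff_distrib)
  qed
  have "\<exists>!z\<in>UNIV. \<Phi> z = z"
    by (rule Banach_fix[where c="1/2"]) (simp_all only: complete_UNIV contr, simp_all)
  then obtain z where z: "\<Phi> z = z" by auto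
  define y where "y k = exp (M * k) * apply_bcontfun z k" for k
  have y_eq: "y k = y0 + integral {0..k} (\<lambda>u. F u (y u))" if "k \<in> {0..T}" for k
  proof -
    have "apply_bcontfun z k = \<Phi>0 z k" using \<Phi>_apply[of z k] z cl_id[OF that] by simp
    then show ?thesis by (simp add: y_def \<Phi>0_def exp_minus)
  qed
  show ?thesis
  proof
    show "y 0 = y0" using y_eq[of 0] T by simp
  next
    fix k assume k: "k \<in> {0..T}"
    have "continuous_on {0..T} (\<lambda>u. F u (y u))" using Fc[of z] by (simp add: y_def)
    then have "((\<lambda>k. integral {0..k} (\<lambda>u. F u (y u))) has_real_derivative F k (y k)) (at k within {0..T})"
      using k by (rule integral_has_real_derivative)
    then have "((\<lambda>k. y0 + integral {0..k} (\<lambda>u. F u (y u))) has_real_derivative F k (y k)) (at k within {0..T})"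
      by (auto intro!: derivative_eq_intros)
    then show "(y has_real_derivative F k (y k)) (at k within {0..T})"
      by (rule has_field_derivative_transform_within[where d=1]) (use k y_eq in auto)
  qed
qed

lemma mono_on_if_deriv_nonneg:
  fixes y :: "real \<Rightarrow> real"
  assumes d: "\<And>k. k \<in> {a..b} \<Longrightarrow> (y has_real_derivative y' k) (at k within {a..b})"
    and nn: "\<And>k. k \<in> {a<..<b} \<Longrightarrow> 0 \<le> y' k"
  shows "mono_on {a..b} y"
proof (rule mono_onI)
  fix u v assume uv: "u \<in> {a..b}" "v \<in> {a..b}" "u \<le> v"
  show "y u \<le> y v"
  proof (cases "u = v")
    case False
    then have "u < v" using uv by simp
    then obtain z where z: "u < z" "z < v" "y v - y u = (v - u) * y' z"
    proof (rule mvt[of u v y "\<lambda>k h. h * y' k"])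
      show "continuous_on {u..v} y"
        using uv by (intro continuous_on_subset[OF DERIV_continuous_on[OF d]]) auto
      show "(y has_derivative (\<lambda>h. h * y' k)) (at k)" if "u < k" "k < v" for k
        using d[of k] that uv by (simp add: at_within_Icc_at has_field_derivative_def mult_commute_abs)
    qed auto
    then have "0 \<le> (v - u) * y' z" using nn[of z] uv by (intro mult_nonneg_nonneg) auto
    then show ?thesis using z by simp
  qed simp
qed

text \<open>Let \<open>a\<close> be the last time up to \<open>k\<close> with
  \<open>D \<le> E\<close>. After \<open>a\<close> the derivative of \<open>D\<close> is at most 0,
  because \<open>G\<close> is decreasing and \<open>D > E\<close>, while \<open>E\<close> does not
  fall; so \<open>D\<close> cannot be above \<open>E\<close> at \<open>k\<close>.\<close>

lemma ode_comparison:
  fixes D E G :: "real \<Rightarrow> real"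
  assumes d: "\<And>k. k \<in> {0..T} \<Longrightarrow> (D has_real_derivative G (D k) - G (E k)) (at k within {0..T})"
    and E: "mono_on {0..T} E" "continuous_on {0..T} E" and G: "antimono G" and init: "D 0 \<le> E 0"
    and k: "k \<in> {0..T}"
  shows "D k \<le> E k"
proof (rule ccontr)
  assume neg: "\<not> D k \<le> E k"
  have Dc: "continuous_on {0..T} D" using d by (rule DERIV_continuous_on)
  define Z where "Z = {u \<in> {0..k}. D u - E u \<le> 0}"
  have "Z = {0..k} \<inter> (\<lambda>u. D u - E u) -` {..0}" by (auto simp: Z_def)
  moreover have "continuous_on {0..k} (\<lambda>u. D u - E u)"
    by (intro continuous_intros continuous_on_subset[OF Dc] continuous_on_subset[OF E(2)]) (use k in auto)
  ultimately have "closed Z" by (simp add: continuous_on_closed_vimage Int_commute)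
  moreover have "bounded Z" by (rule bounded_subset[OF bounded_closed_interval[of 0 k]]) (auto simp: Z_def)
  ultimately have "compact Z" by (simp add: compact_eq_bounded_closed)
  moreover have "0 \<in> Z" using init k by (auto simp: Z_def)
  ultimately obtain a where a: "a \<in> Z" "\<And>u. u \<in> Z \<Longrightarrow> u \<le> a" using compact_attains_sup[of Z] by auto
  have ak: "a \<in> {0..k}" "D a \<le> E a" using a(1) by (auto simp: Z_def)
  have "mono_on {a..k} (\<lambda>u. - D u)"
  proof (rule mono_on_if_deriv_nonneg)
    fix u assume "u \<in> {a..k}"
    then have "(D has_real_derivative G (D u) - G (E u)) (at u within {a..k})"
      using ak k by (intro has_field_derivative_subset[OF d]) auto
    then show "((\<lambda>u. - D u) has_real_derivative - (G (D u) - G (E u))) (at u within {a..k})"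
      by (rule DERIV_minus)
  next
    fix u assume u: "u \<in> {a<..<k}"
    then have "u \<notin> Z" using a(2) by force
    then have "E u \<le> D u" using u ak by (auto simp: Z_def)
    then show "0 \<le> - (G (D u) - G (E u))" using G by (simp add: antimonoD)
  qed
  from mono_onD[OF this, of a k] have "D k \<le> D a" using ak by simp
  also have "\<dots> \<le> E a" by fact
  also have "\<dots> \<le> E k" using ak k mono_onD[OF E(1), of a k] by simp
  finally show False using neg by simp
qed

section \<open>The Hamilton-Jacobi-Bellman system\<close>

locale deterioration_model =
  fixes \<xi> :: nat and smax lam :: real and f r :: "real \<Rightarrow> real" and c :: "nat \<Rightarrow> real"
  assumes smax_pos: "0 < smax"
    and lam_nonneg: "0 \<le> lam"
    and f_nonneg: "\<And>s. s \<in> {0..smax} \<Longrightarrow> 0 \<le> f s"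
    and f_cont: "continuous_on {0..smax} f"
    and f_mono: "mono_on {0..smax} f"
    and f_zero: "f 0 = 0"
    and r_cont: "continuous_on {0..smax} r"
    and r_mono: "mono_on {0..smax} r"
    and c_mono: "mono_on {0..\<xi>} c"
    and c_convex: "\<And>x. x + 2 \<le> \<xi> \<Longrightarrow> c (x + 1) - c x \<le> c (x + 2) - c (x + 1)"
begin

section \<open>The Hamiltonian and its least maximizer\<close>

definition ham :: "real \<Rightarrow> real" where
  "ham d = Sup ((\<lambda>s. r s - lam * f s * d) ` {0..smax})"

text \<open>The least maximizer is singled out because it is monotone in \<open>d\<close> and
  therefore Borel measurable; an arbitrary choice of maximizers need not be.\<close>

definition best_rate :: "real \<Rightarrow> real" where
  "best_rate d = Inf {s \<in> {0..smax}. r s - lam * f s * d = ham d}"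

lemma gain_cont: "continuous_on {0..smax} (\<lambda>s. r s - lam * f s * d)"
  by (intro continuous_intros r_cont f_cont)

lemma gain_le_ham: "s \<in> {0..smax} \<Longrightarrow> r s - lam * f s * d \<le> ham d"
  unfolding ham_def
  by (intro cSUP_upper bounded_imp_bdd_above compact_imp_bounded compact_continuous_image gain_cont) auto

lemma best_rate:
  shows best_rate_in: "best_rate d \<in> {0..smax}"
    and best_rate_ham: "r (best_rate d) - lam * f (best_rate d) * d = ham d"
    and best_rate_le: "\<And>s. s \<in> {0..smax} \<Longrightarrow> r s - lam * f s * d = ham d \<Longrightarrow> best_rate d \<le> s"
proof -
  let ?B = "{s \<in> {0..smax}. r s - lam * f s * d = ham d}"
  have "compact ((\<lambda>s. r s - lam * f s * d) ` {0..smax})"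
    by (intro compact_continuous_image gain_cont) auto
  moreover have "(\<lambda>s. r s - lam * f s * d) ` {0..smax} \<noteq> {}" using smax_pos by auto
  ultimately have "ham d \<in> (\<lambda>s. r s - lam * f s * d) ` {0..smax}"
    unfolding ham_def
    by (intro closed_contains_Sup compact_imp_closed bounded_imp_bdd_above compact_imp_bounded)
  then have ne: "?B \<noteq> {}" by auto
  have "closed ?B"
    using continuous_closed_preimage_constant[OF gain_cont, of d "ham d"] by (auto simp: vimage_def)
  moreover have bdd: "bdd_below ?B" by (rule bdd_belowI[of _ 0]) auto
  ultimately have "Inf ?B \<in> ?B" using ne by (intro closed_contains_Inf)
  then show "best_rate d \<in> {0..smax}" "r (best_rate d) - lam * f (best_rate d) * d = ham d"
    unfolding best_rate_def by auto
  show "best_rate d \<le> s" if "s \<in> {0..smax}" "r s - lam * f s * d = ham d" for s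
    unfolding best_rate_def by (rule cInf_lower) (use that bdd in auto)
qed

text \<open>Exchange argument: \<open>?s\<close> is at least as good as \<open>?u\<close> at the
  price \<open>d\<close>. Raising the price to \<open>e\<close> favours the smaller rate further, as
  \<open>f\<close> increases, so \<open>?s\<close> is a maximizer at \<open>e\<close> as well, which
  contradicts that \<open>?u\<close> is the least one.\<close>

lemma best_rate_antimono: "antimono best_rate"
proof (rule antimonoI, rule ccontr)
  fix d e :: real
  let ?s = "best_rate d" and ?u = "best_rate e"
  assume "d \<le> e" and "\<not> ?u \<le> ?s"
  then have lt: "?s < ?u" by simp
  have "0 \<le> lam * (f ?u - f ?s)"
    using lt best_rate_in lam_nonneg by (intro mult_nonneg_nonneg) (simp_all add: mono_onD[OF f_mono best_rate_in best_rate_in])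
  with \<open>d \<le> e\<close> have "d * (lam * (f ?u - f ?s)) \<le> e * (lam * (f ?u - f ?s))" by (rule mult_right_mono)
  moreover have "r ?u - lam * f ?u * d \<le> r ?s - lam * f ?s * d"
    using gain_le_ham[OF best_rate_in] best_rate_ham by metis
  moreover have "r ?s - lam * f ?s * e \<le> ham e" by (rule gain_le_ham[OF best_rate_in])
  ultimately have "r ?s - lam * f ?s * e = ham e"
    using best_rate_ham[of e] by (simp add: algebra_simps)
  then have "?u \<le> ?s" by (rule best_rate_le[OF best_rate_in])
  with lt show False by simp
qed

lemma best_rate_measurable [measurable]: "best_rate \<in> borel_measurable borel"
proof -
  have "mono (\<lambda>d. - best_rate d)" using best_rate_antimono by (auto simp: monotone_on_def)
  then have "(\<lambda>d. - (- best_rate d)) \<in> borel_measurable borel"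
    by (intro borel_measurable_uminus borel_measurable_mono)
  then show ?thesis by simp
qed

lemma ham_antimono: "antimono ham"
proof (rule antimonoI)
  fix d e :: real assume "d \<le> e"
  then have "lam * f (best_rate e) * d \<le> lam * f (best_rate e) * e"
    using lam_nonneg f_nonneg[OF best_rate_in] by (intro mult_left_mono) auto
  then show "ham e \<le> ham d"
    using best_rate_ham[of e] gain_le_ham[OF best_rate_in, of e d] by linarith
qed

lemma f_le: "s \<in> {0..smax} \<Longrightarrow> f s \<le> f smax"
  using smax_pos by (intro mono_onD[OF f_mono]) auto

text \<open>The maximizer for \<open>d\<close> is a candidate for \<open>e\<close>, so the two
  maxima differ by at most the change of the term \<open>lam * f s * d\<close>. This is the
  Lipschitz constant for \<open>picard_global\<close>.\<close>

lemma ham_lipschitz: "\<bar>ham d - ham e\<bar> \<le> lam * f smax * \<bar>d - e\<bar>"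
proof -
  have *: "ham d - ham e \<le> lam * f smax * \<bar>d - e\<bar>" for d e
  proof -
    have "ham d - ham e \<le> lam * f (best_rate d) * (e - d)"
      using best_rate_ham[of d] gain_le_ham[OF best_rate_in, of d e] by (simp add: algebra_simps)
    also have "\<dots> \<le> lam * f (best_rate d) * \<bar>d - e\<bar>"
      using lam_nonneg f_nonneg[OF best_rate_in] by (intro mult_left_mono) auto
    also have "\<dots> \<le> lam * f smax * \<bar>d - e\<bar>"
      using lam_nonneg f_le[OF best_rate_in] by (intro mult_right_mono mult_left_mono) auto
    finally show ?thesis .
  qed
  show ?thesis using *[of d e] *[of e d] by (simp add: abs_le_iff abs_minus_commute)
qed

lemma ham_cont: "continuous_on A ham"
proof (rule continuous_on_subset)
  have "(lam * f smax)-lipschitz_on UNIV ham"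
    by (rule lipschitz_onI) (use ham_lipschitz lam_nonneg f_nonneg[of smax] smax_pos in \<open>auto simp: dist_real_def\<close>)
  then show "continuous_on UNIV ham" by (rule lipschitz_on_continuous_on)
qed auto

lemma r_0_le_ham: "r 0 \<le> ham d"
  using gain_le_ham[of 0 d] smax_pos f_zero by simp

text \<open>At level \<open>\<xi>\<close> only the rate 0 is admissible, hence \<open>r 0\<close> in
  place of the Hamiltonian. This also makes the system triangular: no level above
  \<open>\<xi>\<close> is referred to.\<close>

definition value_rate :: "(nat \<Rightarrow> real \<Rightarrow> real) \<Rightarrow> nat \<Rightarrow> real \<Rightarrow> real" where
  "value_rate V x k = (if x < \<xi> then ham (V x k - V (Suc x) k) else r 0)"

definition hjb_solution :: "real \<Rightarrow> (nat \<Rightarrow> real \<Rightarrow> real) \<Rightarrow> bool" where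
  "hjb_solution T V \<longleftrightarrow> (\<forall>x\<le>\<xi>. V x 0 = - c x \<and>
     (\<forall>k\<in>{0..T}. (V x has_real_derivative value_rate V x k) (at k within {0..T})))"

text \<open>The triangular system is solved from \<open>\<xi>\<close> downwards. At
  \<open>\<xi>\<close> the solution is linear in time; each lower level is a scalar Lipschitz
  equation in which the level above enters as a known function \<open>w\<close>.\<close>

lemma hjb_solution_exists:
  assumes "0 \<le> T" shows "\<exists>V. hjb_solution T V"
proof -
  have step: "\<exists>y. y 0 = - c x \<and> (\<forall>k\<in>{0..T}. (y has_real_derivative ham (y k - w k)) (at k within {0..T}))"
    if w: "continuous_on {0..T} w" for w :: "real \<Rightarrow> real" and x
  proof -
    obtain y where "y 0 = - c x" "\<And>k. k \<in> {0..T} \<Longrightarrow> (y has_real_derivative ham (y k - w k)) (at k within {0..T})"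
    proof (rule picard_global[where T=T and L="lam * f smax" and F="\<lambda>k y. ham (y - w k)" and ?y0.0="- c x"])
      show "continuous_on {0..T} (\<lambda>k. ham (y k - w k))" if "continuous_on {0..T} y" for y
        by (rule continuous_on_compose2[OF ham_cont[of UNIV]]) (intro continuous_intros that w, auto)
      show "\<bar>ham (y - w k) - ham (z - w k)\<bar> \<le> lam * f smax * \<bar>y - z\<bar>" for k y z
        using ham_lipschitz[of "y - w k" "z - w k"] by simp
    qed (use assms lam_nonneg f_nonneg[of smax] smax_pos in auto)
    then show ?thesis by blast
  qed
  \<comment> \<open>\<open>n\<close> counts levels below \<open>\<xi>\<close>. Truncated subtraction
    repeats level 0 once \<open>n\<close> exceeds \<open>\<xi>\<close>, but in the end only
    \<open>n = \<xi> - x\<close> with \<open>x \<le> \<xi>\<close> is used.\<close>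
  define P where "P n y \<longleftrightarrow> continuous_on {0..T} y \<and> y 0 = - c (\<xi> - n) \<and> (n = 0 \<longrightarrow> y = (\<lambda>k. r 0 * k - c \<xi>))" for n and y :: "real \<Rightarrow> real"
  define Q where "Q n w y \<longleftrightarrow> (\<forall>k\<in>{0..T}. (y has_real_derivative ham (y k - w k)) (at k within {0..T}))"
    for n :: nat and w y :: "real \<Rightarrow> real"
  have "\<exists>U. \<forall>n. P n (U n) \<and> Q n (U n) (U (Suc n))"
  proof (rule dependent_nat_choice)
    show "\<exists>y. P 0 y" by (auto simp: P_def intro!: continuous_intros)
    fix w n assume "P n w"
    then obtain y where "y 0 = - c (\<xi> - Suc n)" "Q n w y"
      using step[of w "\<xi> - Suc n"] unfolding P_def Q_def by blast
    moreover from \<open>Q n w y\<close> have "continuous_on {0..T} y"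
      unfolding Q_def by (intro DERIV_continuous_on) auto
    ultimately show "\<exists>y. P (Suc n) y \<and> Q n w y" by (auto simp: P_def)
  qed
  then obtain U where U: "\<And>n. P n (U n)" "\<And>n. Q n (U n) (U (Suc n))" by auto
  have U0: "U 0 = (\<lambda>k. r 0 * k - c \<xi>)" using U(1)[of 0] by (simp add: P_def)
  have "hjb_solution T (\<lambda>x. U (\<xi> - x))"
    unfolding hjb_solution_def
  proof (intro allI impI conjI ballI)
    fix x assume x: "x \<le> \<xi>"
    show "U (\<xi> - x) 0 = - c x" using U(1)[of "\<xi> - x"] x by (auto simp: P_def)
    fix k assume k: "k \<in> {0..T}"
    show "(U (\<xi> - x) has_real_derivative value_rate (\<lambda>x. U (\<xi> - x)) x k) (at k within {0..T})"
    proof (cases "x < \<xi>")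
      case True
      then have "\<xi> - x = Suc (\<xi> - Suc x)" by simp
      then show ?thesis using U(2)[of "\<xi> - Suc x"] k True by (auto simp: Q_def value_rate_def)
    next
      case False
      then show ?thesis using x by (auto simp: value_rate_def U0 intro!: derivative_eq_intros)
    qed
  qed
  then show ?thesis by blast
qed

section \<open>Monotone marginal values and concavity in the remaining time\<close>

context
  fixes T :: real and V :: "nat \<Rightarrow> real \<Rightarrow> real"
  assumes T: "0 \<le> T" and V: "hjb_solution T V"
begin

lemma V_deriv:
  "x \<le> \<xi> \<Longrightarrow> k \<in> {0..T} \<Longrightarrow> (V x has_real_derivative value_rate V x k) (at k within {0..T})"
  and V_0: "x \<le> \<xi> \<Longrightarrow> V x 0 = - c x"
  using V by (auto simp: hjb_solution_def)

lemma V_cont: "x \<le> \<xi> \<Longrightarrow> continuous_on {0..T} (V x)"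
  using V_deriv by (rule DERIV_continuous_on)

text \<open>Induction from the failure level downwards. The marginal value of \<open>x\<close> has
  derivative \<open>ham\<close> of itself minus \<open>ham\<close> of the next marginal value. By
  convexity of \<open>c\<close> it starts below the next one, which is increasing by induction, so
  \<open>ode_comparison\<close> keeps it below and the derivative stays nonnegative. For the last
  level the subtracted term is \<open>r 0\<close>, and rate 0 is always a candidate in
  \<open>ham\<close>.\<close>

lemma marginal_mono:
  "x < \<xi> \<Longrightarrow> mono_on {0..T} (\<lambda>k. V x k - V (Suc x) k)"
proof (induction "\<xi> - x" arbitrary: x rule: less_induct)
  case (less x)
  let ?D = "\<lambda>x k. V x k - V (Suc x) k"
  have d: "(?D x has_real_derivative ham (?D x k) - value_rate V (Suc x) k) (at k within {0..T})"
    if "k \<in> {0..T}" for k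
    using DERIV_diff[OF V_deriv[of x k] V_deriv[of "Suc x" k]] that less.prems by (simp add: value_rate_def)
  show ?case
  proof (rule mono_on_if_deriv_nonneg[OF d])
    fix k assume "k \<in> {0<..<T}"
    then have k: "k \<in> {0..T}" by simp
    show "0 \<le> ham (?D x k) - value_rate V (Suc x) k"
    proof (cases "Suc x < \<xi>")
      case True
      have "?D x k \<le> ?D (Suc x) k"
      proof (rule ode_comparison[OF _ _ _ ham_antimono _ k])
        show "(?D x has_real_derivative ham (?D x k) - ham (?D (Suc x) k)) (at k within {0..T})"
          if "k \<in> {0..T}" for k
          using d[OF that] True by (simp add: value_rate_def)
        show "mono_on {0..T} (?D (Suc x))" using less True by simp
        show "continuous_on {0..T} (?D (Suc x))" using True by (intro continuous_intros V_cont) auto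
        show "?D x 0 \<le> ?D (Suc x) 0" using True c_convex[of x] by (simp add: V_0)
      qed
      then show ?thesis using True ham_antimono by (simp add: value_rate_def antimonoD)
    qed (simp add: value_rate_def r_0_le_ham)
  qed auto
qed

text \<open>Makes the marginal value an admissible integrand for \<open>intensity\<close>, which
  speaks about \<open>ennreal\<close> only.\<close>

lemma marginal_nonneg:
  assumes "x < \<xi>" "k \<in> {0..T}" shows "0 \<le> V x k - V (Suc x) k"
proof -
  have "0 \<le> c (Suc x) - c x" using assms by (simp add: mono_onD[OF c_mono])
  also have "\<dots> = V x 0 - V (Suc x) 0" using assms by (simp add: V_0)
  also have "\<dots> \<le> V x k - V (Suc x) k" using mono_onD[OF marginal_mono, of x 0 k] assms by simp
  finally show ?thesis .
qed

lemma value_rate_cont: "x \<le> \<xi> \<Longrightarrow> continuous_on {0..T} (value_rate V x)"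
  unfolding value_rate_def
  by (cases "x < \<xi>") (auto intro!: continuous_intros V_cont continuous_on_compose2[OF ham_cont[of UNIV]])

lemma value_rate_antimono:
  assumes "x \<le> \<xi>" "j \<in> {0..T}" "k \<in> {0..T}" "j \<le> k"
  shows "value_rate V x k \<le> value_rate V x j"
  using assms antimonoD[OF ham_antimono mono_onD[OF marginal_mono, of x j k]] by (simp add: value_rate_def)

text \<open>The marginal value grows with the remaining time and \<open>ham\<close> decreases, so
  the derivative of \<open>V x\<close> decreases. The interval is open so that the derivatives are
  two-sided.\<close>

lemma value_concave: "x \<le> \<xi> \<Longrightarrow> concave_on {0<..<T} (V x)"
  unfolding concave_on_def
proof (rule convex_on_realI)
  show "((\<lambda>k. - V x k) has_real_derivative - value_rate V x k) (at k)"
    if "x \<le> \<xi>" "k \<in> {0<..<T}" for k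
    using DERIV_minus[OF V_deriv[of x k]] that by (simp add: at_within_Icc_at)
qed (auto intro: value_rate_antimono)

end

end

section \<open>Unit jump paths\<close>

text \<open>A limit in the discrete topology is attained. The bound \<open>a\<close> allows
  \<open>b\<close> to be kept within the domain of the path.\<close>

lemma eventually_at_left_nat_const:
  fixes p :: "real \<Rightarrow> nat"
  assumes "a < \<tau>"
  shows "(p \<longlongrightarrow> l) (at_left \<tau>) \<longleftrightarrow> (\<exists>b. a \<le> b \<and> b < \<tau> \<and> (\<forall>u. b < u \<and> u < \<tau> \<longrightarrow> p u = l))"
proof -
  have "(p \<longlongrightarrow> l) (at_left \<tau>) \<longleftrightarrow> (\<exists>b<\<tau>. \<forall>u. b < u \<and> u < \<tau> \<longrightarrow> p u = l)"
    by (auto simp: tendsto_discrete eventually_at_left[OF assms])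
  also have "\<dots> \<longleftrightarrow> (\<exists>b. a \<le> b \<and> b < \<tau> \<and> (\<forall>u. b < u \<and> u < \<tau> \<longrightarrow> p u = l))"
  proof
    assume "\<exists>b<\<tau>. \<forall>u. b < u \<and> u < \<tau> \<longrightarrow> p u = l"
    then obtain b where "b < \<tau>" "\<forall>u. b < u \<and> u < \<tau> \<longrightarrow> p u = l" by auto
    then show "\<exists>b. a \<le> b \<and> b < \<tau> \<and> (\<forall>u. b < u \<and> u < \<tau> \<longrightarrow> p u = l)"
      using assms by (intro exI[of _ "max a b"]) auto
  qed auto
  finally show ?thesis .
qed

lemma unit_jump_path_mono:
  assumes "unit_jump_path t p" "0 \<le> u" "u \<le> v" "v \<le> t"
  shows "p u \<le> p v"
  using assms mono_onD[of "{0..t}" p u v] by (simp add: unit_jump_path_def)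

lemma mem_jump_times_iff:
  "\<tau> \<in> jump_times t p \<longleftrightarrow> 0 < \<tau> \<and> \<tau> \<le> t \<and> \<not> (p \<longlongrightarrow> p \<tau>) (at_left \<tau>)"
  by (auto simp: jump_times_def continuous_within)

lemma unit_jump_path_left_limit:
  assumes path: "unit_jump_path t p" and \<tau>: "0 < \<tau>" "\<tau> \<le> t"
  obtains l b where "0 \<le> b" "b < \<tau>" "\<And>u. b < u \<Longrightarrow> u < \<tau> \<Longrightarrow> p u = l"
    "(p \<longlongrightarrow> l) (at_left \<tau>)" "p \<tau> = (if \<tau> \<in> jump_times t p then Suc l else l)"
proof -
  have "\<tau> \<in> {0<..t}" using \<tau> by simp
  with path obtain l where l: "(p \<longlongrightarrow> l) (at_left \<tau>)" "p \<tau> = l \<or> p \<tau> = l + 1"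
    unfolding unit_jump_path_def by blast
  have uniq: "l = p \<tau>" if "(p \<longlongrightarrow> p \<tau>) (at_left \<tau>)"
    by (rule tendsto_unique[OF _ l(1) that]) (simp add: trivial_limit_at_left_real)
  from l(1) obtain b where "0 \<le> b" "b < \<tau>" "\<forall>u. b < u \<and> u < \<tau> \<longrightarrow> p u = l"
    using eventually_at_left_nat_const[OF \<tau>(1)] by auto
  moreover have "p \<tau> = (if \<tau> \<in> jump_times t p then Suc l else l)"
    using l uniq \<tau> by (auto simp: mem_jump_times_iff)
  ultimately show ?thesis using that l(1) by blast
qed

text \<open>Induction step for removing jumps: \<open>T\<close> is the first time at which the final
  level is reached. Lowering the value at \<open>T\<close> to the left limit deletes exactly this
  jump; without the change \<open>T\<close> would still count, because \<open>jump_times\<close>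
  includes the right end of the interval.\<close>

lemma unit_jump_path_last_jump:
  assumes path: "unit_jump_path t p" and t: "0 \<le> t" and inc: "p 0 < p t"
  obtains T where "0 < T" "T \<le> t" "\<And>u. u \<in> {T..t} \<Longrightarrow> p u = p t"
    "unit_jump_path T (p(T := p t - 1))" "jump_times t p = insert T (jump_times T (p(T := p t - 1)))"
    "T \<notin> jump_times T (p(T := p t - 1))"
proof -
  have mono: "p u \<le> p v" if "0 \<le> u" "u \<le> v" "v \<le> t" for u v
    using unit_jump_path_mono[OF path] that .
  define Z where "Z = {\<tau> \<in> {0..t}. p \<tau> = p t}"
  define T where "T = Inf Z"
  have tZ: "t \<in> Z" using t by (simp add: Z_def)
  have bdd: "bdd_below Z" by (rule bdd_belowI[of _ 0]) (auto simp: Z_def)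
  have T0: "0 \<le> T" "T \<le> t"
    unfolding T_def using tZ by (auto intro!: cInf_greatest cInf_lower bdd simp: Z_def)
  \<comment> \<open>By right continuity \<open>p\<close> is constant just after the infimum
    \<open>T\<close>, and there are elements of \<open>Z\<close> arbitrarily close to
    \<open>T\<close>; hence the infimum is attained.\<close>
  have pT: "p T = p t"
  proof (cases "T = t")
    case False
    then have "T < t" using T0 by simp
    then have "continuous (at_right T) p" using path T0 by (auto simp: unit_jump_path_def)
    then have "\<forall>\<^sub>F u in at_right T. p u = p T" by (simp add: continuous_within tendsto_discrete)
    then obtain b where b: "T < b" "\<And>u. T < u \<Longrightarrow> u < b \<Longrightarrow> p u = p T"
      using eventually_at_right[OF \<open>T < t\<close>] by auto
    obtain z where z: "z \<in> Z" "z < b"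
      using b(1) cInf_lessD[of Z b] tZ by (auto simp: T_def)
    have "T \<le> z" unfolding T_def using z(1) bdd by (rule cInf_lower)
    then show ?thesis using b(2)[of z] z by (cases "z = T") (auto simp: Z_def)
  qed simp
  have Tpos: "0 < T" using pT inc T0 by (cases "T = 0") auto
  have before: "p u < p t" if "0 \<le> u" "u < T" for u
  proof -
    have "u \<notin> Z" using that cInf_lower[OF _ bdd, of u] by (auto simp: T_def)
    then have "p u \<noteq> p t" using that T0 by (simp add: Z_def)
    moreover have "p u \<le> p t" using that T0 by (intro mono) auto
    ultimately show ?thesis by simp
  qed
  have after: "p u = p t" if "u \<in> {T..t}" for u
    using mono[of T u] mono[of u t] that T0 pT by auto
  obtain l b where l: "0 \<le> b" "b < T" "\<And>u. b < u \<Longrightarrow> u < T \<Longrightarrow> p u = l" "(p \<longlongrightarrow> l) (at_left T)"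
    "p T = (if T \<in> jump_times t p then Suc l else l)"
    using unit_jump_path_left_limit[OF path Tpos T0(2)] by metis
  have "l < p t"
  proof -
    have "p ((b + T) / 2) = l" using l by (intro l(3)) auto
    moreover have "p ((b + T) / 2) < p t" using l by (intro before) auto
    ultimately show ?thesis by simp
  qed
  then have TJ: "T \<in> jump_times t p" and pl: "p t = Suc l" using l(5) pT by (auto split: if_splits)
  let ?q = "p(T := p t - 1)"
  have q_l: "(?q \<longlongrightarrow> m) (at_left \<tau>) \<longleftrightarrow> (p \<longlongrightarrow> m) (at_left \<tau>)" if "\<tau> \<le> T" for \<tau> m
    by (rule tendsto_cong) (use that in \<open>auto simp: eventually_at_filter\<close>)
  have q_r: "continuous (at_right \<tau>) ?q \<longleftrightarrow> continuous (at_right \<tau>) p" if "\<tau> < T" for \<tau>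
  proof -
    have "\<forall>\<^sub>F u in at_right \<tau>. u < T" using that by (rule eventually_at_rightI[rotated]) auto
    then have "\<forall>\<^sub>F u in at_right \<tau>. ?q u = p u" by eventually_elim auto
    then show ?thesis using that by (simp add: continuous_within tendsto_cong)
  qed
  have "unit_jump_path T ?q"
    unfolding unit_jump_path_def
  proof (intro conjI ballI)
    show "mono_on {0..T} ?q"
    proof (rule mono_onI)
      fix u v assume "u \<in> {0..T}" "v \<in> {0..T}" "u \<le> v"
      then show "?q u \<le> ?q v" using mono[of u v] before[of u] T0 pl by auto
    qed
    show "continuous (at_right \<tau>) ?q" if "\<tau> \<in> {0..<T}" for \<tau>
      using that q_r[of \<tau>] path T0 by (auto simp: unit_jump_path_def)
    show "\<exists>m. (?q \<longlongrightarrow> m) (at_left \<tau>) \<and> (?q \<tau> = m \<or> ?q \<tau> = m + 1)" if "\<tau> \<in> {0<..T}" for \<tau>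
    proof (cases "\<tau> = T")
      case True
      then show ?thesis using l(4) q_l[of T l] pl by auto
    next
      case False
      then show ?thesis using that q_l[of \<tau>] path T0 by (auto simp: unit_jump_path_def)
    qed
  qed
  moreover have Tq: "T \<notin> jump_times T ?q"
    using l(4) q_l[of T l] pl by (simp add: mem_jump_times_iff)
  moreover have "jump_times t p = insert T (jump_times T ?q)"
  proof (rule set_eqI)
    fix \<tau>
    consider "\<tau> < T" | "\<tau> = T" | "T < \<tau>" by linarith
    then show "\<tau> \<in> jump_times t p \<longleftrightarrow> \<tau> \<in> insert T (jump_times T ?q)"
    proof cases
      case 1 then show ?thesis using q_l[of \<tau>] T0 by (auto simp: mem_jump_times_iff)
    next
      case 2 then show ?thesis using TJ by simp
    next
      case 3
      have "(p \<longlongrightarrow> p \<tau>) (at_left \<tau>)" if "\<tau> \<le> t"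
      proof -
        have "p u = p \<tau>" if "T < u" "u < \<tau>" for u
          using after[of u] after[of \<tau>] that \<open>\<tau> \<le> t\<close> 3 by simp
        then show ?thesis unfolding eventually_at_left_nat_const[OF 3] using 3 by blast
      qed
      then show ?thesis using 3 by (auto simp: mem_jump_times_iff)
    qed
  qed
  ultimately show ?thesis using that Tpos T0 after by blast
qed

text \<open>Induction on the number of jumps, which is \<open>p t - p 0\<close> since all jumps are
  of size one. The constant stretch after the last jump is the fundamental theorem of calculus; the
  induction hypothesis is applied to the path with that jump removed.\<close>

lemma path_change_of_variables:
  fixes W w :: "nat \<Rightarrow> real \<Rightarrow> real"
  assumes "unit_jump_path t p" "0 \<le> t" "p t \<le> m"
    and "\<And>y \<tau>. y \<le> m \<Longrightarrow> \<tau> \<in> {0..t} \<Longrightarrow> (W y has_real_derivative w y \<tau>) (at \<tau> within {0..t})"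
  shows "finite (jump_times t p) \<and>
    ((\<lambda>\<tau>. w (p \<tau>) \<tau>) has_integral
      W (p t) t - W (p 0) 0 - (\<Sum>\<tau>\<in>jump_times t p. W (p \<tau>) \<tau> - W (p \<tau> - 1) \<tau>)) {0..t}"
  using assms
proof (induction "p t - p 0" arbitrary: p t)
  case 0
  have ftc: "(w (p t) has_integral W (p t) t - W (p t) 0) {0..t}"
    using 0 by (intro fundamental_theorem_of_calculus)
      (auto simp flip: has_real_derivative_iff_has_vector_derivative)
  have const: "p u = p t" if "u \<in> {0..t}" for u
  proof -
    have "p 0 \<le> p u" "p u \<le> p t" using unit_jump_path_mono[OF \<open>unit_jump_path t p\<close>] that by simp_all
    then show ?thesis using 0 by simp
  qed
  have "\<tau> \<notin> jump_times t p" for \<tau>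
  proof -
    have "(p \<longlongrightarrow> p \<tau>) (at_left \<tau>)" if "0 < \<tau>" "\<tau> \<le> t"
    proof -
      have "p u = p \<tau>" if "0 < u" "u < \<tau>" for u
        using const[of u] const[of \<tau>] that \<open>\<tau> \<le> t\<close> by simp
      then show ?thesis unfolding eventually_at_left_nat_const[OF that(1)] using that by blast
    qed
    then show ?thesis by (auto simp: mem_jump_times_iff)
  qed
  then have "jump_times t p = {}" by auto
  moreover have "p 0 = p t" using const[of 0] \<open>0 \<le> t\<close> by simp
  moreover have "((\<lambda>\<tau>. w (p \<tau>) \<tau>) has_integral W (p t) t - W (p t) 0) {0..t}"
    using ftc by (rule has_integral_eq[rotated]) (metis const)
  ultimately show ?case by simp
next
  case (Suc n)
  obtain T where T: "0 < T" "T \<le> t" "\<And>u. u \<in> {T..t} \<Longrightarrow> p u = p t"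
    "unit_jump_path T (p(T := p t - 1))" "jump_times t p = insert T (jump_times T (p(T := p t - 1)))"
    "T \<notin> jump_times T (p(T := p t - 1))"
    using unit_jump_path_last_jump[OF Suc.prems(1,2)] Suc.hyps(2) by (metis zero_less_Suc zero_less_diff)
  let ?q = "p(T := p t - 1)"
  let ?S = "\<lambda>p A. \<Sum>\<tau>\<in>A. W (p \<tau>) \<tau> - W (p \<tau> - 1) \<tau>"
  have pT: "p T = p t" using T(3)[of T] T(2) by simp
  have IH: "finite (jump_times T ?q) \<and> ((\<lambda>\<tau>. w (?q \<tau>) \<tau>) has_integral
      W (?q T) T - W (?q 0) 0 - ?S ?q (jump_times T ?q)) {0..T}"
  proof (rule Suc.hyps(1)[OF _ T(4)])
    show "(W y has_real_derivative w y \<tau>) (at \<tau> within {0..T})" if "y \<le> m" "\<tau> \<in> {0..T}" for y \<tau>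
      using that T(2) by (intro has_field_derivative_subset[OF Suc.prems(4)]) auto
  qed (use Suc.hyps(2) Suc.prems(3) T(1) in auto)
  then have fin: "finite (jump_times T ?q)" and int_q: "((\<lambda>\<tau>. w (?q \<tau>) \<tau>) has_integral
      W (p t - 1) T - W (p 0) 0 - ?S ?q (jump_times T ?q)) {0..T}"
    using T(1) by auto
  have S_eq: "?S ?q (jump_times T ?q) = ?S p (jump_times T ?q)"
    using T(6) by (intro sum.cong) (metis fun_upd_other)+
  \<comment> \<open>On \<open>{0..T}\<close> the paths \<open>?q\<close> and \<open>p\<close> differ
    at \<open>T\<close> only.\<close>
  have int1: "((\<lambda>\<tau>. w (p \<tau>) \<tau>) has_integral W (p t - 1) T - W (p 0) 0 - ?S p (jump_times T ?q)) {0..T}"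
    by (rule has_integral_spike_finite[OF _ _ int_q[unfolded S_eq], where S="{T}"]) auto
  have "(W (p t) has_real_derivative w (p t) u) (at u within {T..t})" if "u \<in> {T..t}" for u
    by (rule has_field_derivative_subset[OF Suc.prems(4)]) (use that T(1) Suc.prems(3) in auto)
  then have "(w (p t) has_integral W (p t) t - W (p t) T) {T..t}"
    using T(2) by (intro fundamental_theorem_of_calculus)
      (auto simp flip: has_real_derivative_iff_has_vector_derivative)
  then have int2: "((\<lambda>\<tau>. w (p \<tau>) \<tau>) has_integral W (p t) t - W (p t) T) {T..t}"
    by (rule has_integral_eq[rotated]) (metis T(3))
  have "?S p (jump_times t p) = W (p t) T - W (p t - 1) T + ?S p (jump_times T ?q)"
    using T(5,6) fin pT by simp
  then have "(W (p t - 1) T - W (p 0) 0 - ?S p (jump_times T ?q)) + (W (p t) t - W (p t) T)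
      = W (p t) t - W (p 0) 0 - ?S p (jump_times t p)"
    by linarith
  moreover have "((\<lambda>\<tau>. w (p \<tau>) \<tau>) has_integral
      (W (p t - 1) T - W (p 0) 0 - ?S p (jump_times T ?q)) + (W (p t) t - W (p t) T)) {0..t}"
    by (rule has_integral_combine[OF _ T(2) int1 int2]) (use T(1) in auto)
  ultimately show ?case using T(5) fin by (metis finite_insert)
qed

section \<open>Predictability and left limits\<close>

text \<open>Isolates what the predictable sigma-algebra requires, so that the same facts serve an
  arbitrary controlled system and the process constructed later, before the latter is known to be a
  controlled system.\<close>

locale subfiltration = filtration "space M" F for M :: "'w measure" and F :: "real \<Rightarrow> 'w measure" +
  fixes t :: real
  assumes sub: "\<And>\<tau>. sets (F \<tau>) \<subseteq> sets M"
    and horizon: "0 \<le> t"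
begin

abbreviation "pred_sigma \<equiv> predictable_sigma t (space M) F"

lemma space_predictable: "space pred_sigma = {0..t} \<times> space M"
  and sets_predictable: "sets pred_sigma = sigma_sets ({0..t} \<times> space M)
     ({{0} \<times> A |A. A \<in> sets (F 0)} \<union>
      {{a<..b} \<times> A |a b A. 0 \<le> a \<and> a \<le> b \<and> b \<le> t \<and> A \<in> sets (F a)})"
proof -
  have "({{0} \<times> A |A. A \<in> sets (F 0)} \<union>
      {{a<..b} \<times> A |a b A. 0 \<le> a \<and> a \<le> b \<and> b \<le> t \<and> A \<in> sets (F a)}) \<subseteq> Pow ({0..t} \<times> space M)"
    using horizon sets.sets_into_space[of _ "F _"] by (fastforce simp: space_F)
  then show "space pred_sigma = {0..t} \<times> space M" "sets pred_sigma = sigma_sets ({0..t} \<times> space M)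
     ({{0} \<times> A |A. A \<in> sets (F 0)} \<union>
      {{a<..b} \<times> A |a b A. 0 \<le> a \<and> a \<le> b \<and> b \<le> t \<and> A \<in> sets (F a)})"
    unfolding predictable_sigma_def by (rule space_measure_of, rule sets_measure_of)
qed

lemma predictable_initial: "A \<in> sets (F 0) \<Longrightarrow> {0} \<times> A \<in> sets pred_sigma"
  unfolding sets_predictable by (rule sigma_sets.Basic) blast

lemma predictable_rectangle:
  "0 \<le> a \<Longrightarrow> a \<le> b \<Longrightarrow> b \<le> t \<Longrightarrow> A \<in> sets (F a) \<Longrightarrow> {a<..b} \<times> A \<in> sets pred_sigma"
  unfolding sets_predictable by (rule sigma_sets.Basic) blast

lemma predictable_sets_joint: "sets pred_sigma \<subseteq> sets (borel \<Otimes>\<^sub>M M)"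
proof -
  let ?R = "restrict_space (borel \<Otimes>\<^sub>M M) ({0..t} \<times> space M)"
  have S: "{0..t} \<times> space M \<in> sets (borel \<Otimes>\<^sub>M M)" by auto
  have sp: "space ?R = {0..t} \<times> space M" by (auto simp: space_restrict_space space_pair_measure)
  have "A \<in> sets M" "A \<subseteq> space M" if "A \<in> sets (F \<tau>)" for A \<tau>
    using that sub[of \<tau>] sets.sets_into_space[OF that] by (auto simp: space_F)
  then have "sigma_sets (space ?R) ({{0} \<times> A |A. A \<in> sets (F 0)} \<union>
      {{a<..b} \<times> A |a b A. 0 \<le> a \<and> a \<le> b \<and> b \<le> t \<and> A \<in> sets (F a)}) \<subseteq> sets ?R"
    using horizon S by (intro sets.sigma_sets_subset) (auto simp: sets_restrict_space_iff, blast+)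
  then show ?thesis
    unfolding sets_predictable sp using S by (auto simp: sets_restrict_space_iff)
qed

text \<open>Cutting \<open>C\<close> off outside \<open>{0..t}\<close> turns it into a measurable
  function on the whole product space, as required by Fubini.\<close>

lemma predictable_joint_measurable:
  fixes C :: "real \<times> 'w \<Rightarrow> ennreal"
  assumes "C \<in> borel_measurable pred_sigma"
  shows "(\<lambda>p. C p * indicator ({0..t} \<times> space M) p) \<in> borel_measurable (borel \<Otimes>\<^sub>M M)"
proof -
  let ?R = "restrict_space (borel \<Otimes>\<^sub>M M) ({0..t} \<times> space M)"
  have S: "{0..t} \<times> space M \<in> sets (borel \<Otimes>\<^sub>M M)" by auto
  have "C \<in> borel_measurable ?R"
  proof (rule measurableI)
    fix B :: "ennreal set" assume "B \<in> sets borel"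
    then have "C -` B \<inter> space pred_sigma \<in> sets pred_sigma" by (rule measurable_sets[OF assms])
    then have "C -` B \<inter> space pred_sigma \<in> sets (borel \<Otimes>\<^sub>M M)" using predictable_sets_joint by auto
    moreover have "space ?R = {0..t} \<times> space M" by (auto simp: space_restrict_space space_pair_measure)
    ultimately show "C -` B \<inter> space ?R \<in> sets ?R"
      using S by (simp add: sets_restrict_space_iff space_predictable)
  qed simp
  then show ?thesis
    using S by (subst (asm) borel_measurable_restrict_space_iff_ennreal) (auto simp: mult.commute)
qed

lemma fst_predictable: "fst \<in> borel_measurable pred_sigma"
proof (rule borel_measurableI_le)
  fix b :: real
  have sp: "space M \<in> sets (F \<tau>)" for \<tau> using sets.top[of "F \<tau>"] by (simp add: space_F)
  show "{p \<in> space pred_sigma. fst p \<le> b} \<in> sets pred_sigma"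
  proof (cases "0 \<le> b")
    case True
    then have "{p \<in> space pred_sigma. fst p \<le> b} = {0} \<times> space M \<union> {0<..min b t} \<times> space M"
      using horizon by (auto simp: space_predictable)
    then show ?thesis using predictable_initial[OF sp] predictable_rectangle[OF _ _ _ sp, of 0 "min b t"] True horizon
      by auto
  next
    case False
    then have "{p \<in> space pred_sigma. fst p \<le> b} = {}" by (auto simp: space_predictable)
    then show ?thesis by (simp only: sets.empty_sets)
  qed
qed

end

lemma (in prob_space) time_integral_integrable:
  fixes h :: "real \<Rightarrow> 'a \<Rightarrow> real"
  assumes h: "case_prod h \<in> borel_measurable (borel \<Otimes>\<^sub>M M)"
    and bound: "\<And>\<tau> \<omega>. \<tau> \<in> {0..t} \<Longrightarrow> \<omega> \<in> space M \<Longrightarrow> \<bar>h \<tau> \<omega>\<bar> \<le> B"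
  shows time_section_integrable: "\<And>\<omega>. \<omega> \<in> space M \<Longrightarrow> set_integrable lborel {0..t} (\<lambda>\<tau>. h \<tau> \<omega>)"
    and "integrable M (\<lambda>\<omega>. LINT \<tau>:{0..t}|lborel. h \<tau> \<omega>)"
proof -
  have [measurable]: "case_prod h \<in> borel_measurable (lborel \<Otimes>\<^sub>M M)" using h by simp
  show si: "set_integrable lborel {0..t} (\<lambda>\<tau>. h \<tau> \<omega>)" if "\<omega> \<in> space M" for \<omega>
    unfolding set_integrable_def
  proof (rule integrableI_bounded_set_indicator[where B=B])
    have "(\<lambda>\<tau>. case_prod h (\<tau>, \<omega>)) \<in> borel_measurable lborel"
      using that by measurable
    then show "(\<lambda>\<tau>. h \<tau> \<omega>) \<in> borel_measurable lborel" by simp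
  qed (use that bound in \<open>auto simp: emeasure_lborel_Icc_eq\<close>)
  have "(\<lambda>\<omega>. \<integral>\<tau>. indicator {0..t} \<tau> *\<^sub>R h \<tau> \<omega> \<partial>lborel) \<in> borel_measurable M"
  proof (rule lborel.borel_measurable_lebesgue_integral)
    have "(\<lambda>p. case_prod h (snd p, fst p)) \<in> borel_measurable (M \<Otimes>\<^sub>M lborel)" by measurable
    then have [measurable]: "(\<lambda>(\<omega>, \<tau>). h \<tau> \<omega>) \<in> borel_measurable (M \<Otimes>\<^sub>M lborel)"
      by (simp add: case_prod_beta')
    show "(\<lambda>(\<omega>, \<tau>). indicator {0..t} \<tau> *\<^sub>R h \<tau> \<omega>) \<in> borel_measurable (M \<Otimes>\<^sub>M lborel)"
      by (simp add: case_prod_beta') measurable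
  qed
  then have meas: "(\<lambda>\<omega>. LINT \<tau>:{0..t}|lborel. h \<tau> \<omega>) \<in> borel_measurable M"
    by (simp add: set_lebesgue_integral_def)
  show "integrable M (\<lambda>\<omega>. LINT \<tau>:{0..t}|lborel. h \<tau> \<omega>)"
  proof (rule integrable_const_bound[OF _ meas])
    have "norm (LINT \<tau>:{0..t}|lborel. h \<tau> \<omega>) \<le> (LINT \<tau>:{0..t}|lborel. B)" if "\<omega> \<in> space M" for \<omega>
    proof -
      have "norm (LINT \<tau>:{0..t}|lborel. h \<tau> \<omega>) \<le> (LINT \<tau>:{0..t}|lborel. norm (h \<tau> \<omega>))"
        using si[OF that] by (rule set_integral_norm_bound)
      also have "\<dots> \<le> (LINT \<tau>:{0..t}|lborel. B)"
        using that bound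
        by (intro set_integral_mono set_integrable_norm si borel_integrable_atLeastAtMost') auto
      finally show ?thesis .
    qed
    then show "AE \<omega> in M. norm (LINT \<tau>:{0..t}|lborel. h \<tau> \<omega>) \<le> (LINT \<tau>:{0..t}|lborel. B)" by auto
  qed
qed

context controlled_system
begin

text \<open>The assumptions control \<open>s\<close> only on \<open>{0..t}\<close> and
  \<open>h\<close> only on \<open>{0..smax}\<close>. Clamping the time and the rate extends both
  measurably and changes nothing where the indicator is 1.\<close>

lemma rate_joint_measurable:
  fixes h :: "real \<Rightarrow> real"
  assumes t: "0 \<le> t" and h: "continuous_on {0..smax} h"
  shows "(\<lambda>(\<tau>, \<omega>). indicator {0..t} \<tau> * h (s \<tau> \<omega>)) \<in> borel_measurable (borel \<Otimes>\<^sub>M M)"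
proof -
  define cl where "cl \<tau> = max 0 (min t \<tau>)" for \<tau> :: real
  have [measurable]: "(\<lambda>p. (cl (fst p), snd p)) \<in> borel \<Otimes>\<^sub>M M \<rightarrow>\<^sub>M restrict_space borel {0..t} \<Otimes>\<^sub>M F t"
  proof (rule measurable_Pair)
    have "(\<lambda>p. cl (fst p)) \<in> borel \<Otimes>\<^sub>M M \<rightarrow>\<^sub>M borel" unfolding cl_def by measurable
    then show "(\<lambda>p. cl (fst p)) \<in> borel \<Otimes>\<^sub>M M \<rightarrow>\<^sub>M restrict_space borel {0..t}"
      by (rule measurable_restrict_space2[rotated]) (use t in \<open>auto simp: cl_def\<close>)
    have "(\<lambda>\<omega>. \<omega>) \<in> M \<rightarrow>\<^sub>M F t"
      using subalgebra[of t] by (intro measurableI) (auto simp: subalgebra_def dest: sets.sets_into_space)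
    then show "snd \<in> borel \<Otimes>\<^sub>M M \<rightarrow>\<^sub>M F t"
      by (rule measurable_compose[OF measurable_snd, unfolded comp_def])
  qed
  have "case_prod s \<in> borel_measurable (restrict_space borel {0..t} \<Otimes>\<^sub>M F t)"
    using rate_progressive[of t] t by simp
  then have s'[measurable]: "(\<lambda>p. s (cl (fst p)) (snd p)) \<in> borel_measurable (borel \<Otimes>\<^sub>M M)"
    by (rule measurable_compose[rotated, where g="case_prod s", simplified, OF _ \<open>(\<lambda>p. (cl (fst p), snd p)) \<in> _\<close>, unfolded split])
  show ?thesis
  proof (cases "0 \<le> smax")
    case True
    have "continuous_on UNIV (\<lambda>x. h (max 0 (min smax x)))"
      by (rule continuous_on_compose2[OF h]) (use True in \<open>auto intro!: continuous_intros\<close>)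
    then have [measurable]: "(\<lambda>x. h (max 0 (min smax x))) \<in> borel_measurable borel"
      by (rule borel_measurable_continuous_onI)
    have "(\<lambda>p. indicator {0..t} (fst p) * h (max 0 (min smax (s (cl (fst p)) (snd p))))) \<in> borel_measurable (borel \<Otimes>\<^sub>M M)"
      by measurable
    moreover have "indicator {0..t} (fst p) * h (max 0 (min smax (s (cl (fst p)) (snd p))))
        = (\<lambda>(\<tau>, \<omega>). indicator {0..t} \<tau> * h (s \<tau> \<omega>)) p" if "p \<in> space (borel \<Otimes>\<^sub>M M)" for p
    proof (cases "fst p \<in> {0..t}")
      case True
      moreover have "s (fst p) (snd p) \<in> {0..smax}"
        using True that by (intro rate_range) (auto simp: space_pair_measure)
      ultimately show ?thesis by (simp add: case_prod_beta' cl_def)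
    qed (simp add: case_prod_beta')
    ultimately show ?thesis by (simp cong: measurable_cong)
  next
    case False
    \<comment> \<open>For negative \<open>smax\<close> no rate lies in \<open>{0..smax}\<close>, so
      there could be no sample points, contrary to total mass 1.\<close>
    then have "space M = {}" using rate_range[of 0] t by fastforce
    then show ?thesis using not_empty by simp
  qed
qed

lemma subfiltration:
  assumes "0 \<le> t" shows "subfiltration M F t"
proof (intro subfiltration.intro subfiltration_axioms.intro)
  show "filtration (space M) F" by (rule filtration_axioms)
  show "sets (F \<tau>) \<subseteq> sets M" for \<tau> using subalgebra[of \<tau>] by (simp add: subalgebra_def)
qed fact

text \<open>
  The left limit of the level is \<open>y\<close>, read off at the last multiple of \<open>1 / (n + 1)\<close> strictly before \<open>\<tau>\<close>;
  this representation makes the event predictable.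
\<close>

definition left_level :: "nat \<Rightarrow> (real \<times> 'w) set" where
  "left_level y = {(\<tau>, \<omega>). 0 < \<tau> \<and> \<tau> \<le> t \<and> \<omega> \<in> space M \<and>
     (\<exists>N. \<forall>n\<ge>N. X (of_int (\<lceil>\<tau> * Suc n\<rceil> - 1) / Suc n) \<omega> = y)}"

text \<open>On a grid cell the level at its left end point is already known at that end point, so
  \<open>E n\<close> is a countable union of predictable rectangles. \<open>left_level y\<close> is
  the lower limit of these sets.\<close>

lemma left_level_predictable:
  assumes t: "0 \<le> t"
  shows "left_level y \<in> sets (predictable_sigma t (space M) F)"
proof -
  interpret subfiltration M F t using t by (rule subfiltration)
  define E where "E n = (\<Union>j\<in>{j::nat. j / Suc n \<le> t}. {real j / Suc n<..min t (real (Suc j) / Suc n)} \<times>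
    {\<omega> \<in> space M. X (real j / Suc n) \<omega> = y})" for n
  have "E n \<in> sets pred_sigma" for n
    unfolding E_def
  proof (rule sets.countable_UN'')
    fix j assume j: "j \<in> {j::nat. j / Suc n \<le> t}"
    have A: "{\<omega> \<in> space (F (real j / Suc n)). X (real j / Suc n) \<omega> = y} \<in> sets (F (real j / Suc n))"
      by (rule measurable_sets_Collect[OF level_adapted]) (use j in auto)
    show "{real j / Suc n<..min t (real (Suc j) / Suc n)} \<times>
        {\<omega> \<in> space M. X (real j / Suc n) \<omega> = y} \<in> sets pred_sigma"
      using j t A by (intro predictable_rectangle) (auto simp: space_F divide_right_mono)
  qed auto
  moreover have "left_level y = (\<Union>N. \<Inter>n\<in>{N..}. E n)"
  proof -
    have E_iff: "(\<tau>, \<omega>) \<in> E n \<longleftrightarrow> 0 < \<tau> \<and> \<tau> \<le> t \<and> \<omega> \<in> space M \<and> X (of_int (\<lceil>\<tau> * Suc n\<rceil> - 1) / Suc n) \<omega> = y"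
      for \<tau> :: real and \<omega> :: 'w and n :: nat
    proof
      assume "(\<tau>, \<omega>) \<in> E n"
      then obtain j :: nat where j: "j / Suc n < \<tau>" "\<tau> \<le> t" "\<tau> \<le> real (Suc j) / Suc n" "\<omega> \<in> space M"
        "X (real j / Suc n) \<omega> = y" unfolding E_def by auto
      \<comment> \<open>The ceiling minus one selects the grid point strictly below \<tau>, also
        when \<tau> itself is on the grid.\<close>
      have "\<lceil>\<tau> * Suc n\<rceil> = int (Suc j)"
        using j by (intro ceiling_unique) (auto simp: field_simps)
      moreover have "0 < \<tau>" by (rule le_less_trans[OF _ j(1)]) simp
      ultimately show "0 < \<tau> \<and> \<tau> \<le> t \<and> \<omega> \<in> space M \<and> X (of_int (\<lceil>\<tau> * Suc n\<rceil> - 1) / Suc n) \<omega> = y"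
        using j by simp
    next
      assume *: "0 < \<tau> \<and> \<tau> \<le> t \<and> \<omega> \<in> space M \<and> X (of_int (\<lceil>\<tau> * Suc n\<rceil> - 1) / Suc n) \<omega> = y"
      define j where "j = nat (\<lceil>\<tau> * Suc n\<rceil> - 1)"
      have "0 < \<lceil>\<tau> * Suc n\<rceil>" using * by simp
      then have j: "real j = of_int (\<lceil>\<tau> * Suc n\<rceil> - 1)" by (simp add: j_def)
      have "real j < \<tau> * Suc n" "\<tau> * Suc n \<le> real j + 1" unfolding j by linarith+
      then have "real j / Suc n < \<tau>" "\<tau> \<le> real (Suc j) / Suc n" by (auto simp: field_simps)
      then show "(\<tau>, \<omega>) \<in> E n" unfolding E_def using * j by (intro UN_I[of j]) auto
    qed
    show ?thesis
    proof (rule set_eqI, clarify)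
      fix \<tau> :: real and \<omega> :: 'w
      have "(\<tau>, \<omega>) \<in> (\<Union>N. \<Inter>n\<in>{N..}. E n) \<longleftrightarrow> (\<exists>N. \<forall>n\<ge>N. (\<tau>, \<omega>) \<in> E n)" by auto
      also have "\<dots> \<longleftrightarrow> (\<tau>, \<omega>) \<in> left_level y" unfolding E_iff left_level_def by auto
      finally show "(\<tau>, \<omega>) \<in> left_level y \<longleftrightarrow> (\<tau>, \<omega>) \<in> (\<Union>N. \<Inter>n\<in>{N..}. E n)" by simp
    qed
  qed
  ultimately show ?thesis by (auto intro!: sets.countable_UN sets.countable_INT')
qed

text \<open>Once the mesh 1 / (n + 1) is smaller than \<open>\<tau> - b\<close>, the grid point used
  by \<open>left_level\<close> falls into the stretch between \<open>b\<close> and \<tau> on which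
  the level is \<open>l\<close>. Thus the sampled levels are eventually \<open>l\<close> and no
  other value.\<close>

lemma left_level_iff:
  assumes \<tau>: "0 < \<tau>" "\<tau> \<le> t" "\<omega> \<in> space M"
    and b: "0 \<le> b" "b < \<tau>" "\<And>u. b < u \<Longrightarrow> u < \<tau> \<Longrightarrow> X u \<omega> = l"
  shows "(\<tau>, \<omega>) \<in> left_level y \<longleftrightarrow> y = l"
proof -
  obtain N :: nat where N: "1 / (\<tau> - b) < N" using reals_Archimedean2 by blast
  have "X (of_int (\<lceil>\<tau> * Suc n\<rceil> - 1) / Suc n) \<omega> = l" if "N \<le> n" for n
  proof (rule b(3))
    have "1 / (\<tau> - b) < Suc n" using N that by linarith
    then have "1 < Suc n * (\<tau> - b)" using b(2) by (simp add: field_simps)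
    then have "b * Suc n < \<tau> * Suc n - 1" by (simp add: algebra_simps)
    then have "b * Suc n < of_int (\<lceil>\<tau> * Suc n\<rceil> - 1)" "of_int (\<lceil>\<tau> * Suc n\<rceil> - 1) < \<tau> * Suc n" by linarith+
    then show "b < of_int (\<lceil>\<tau> * Suc n\<rceil> - 1) / Suc n" "of_int (\<lceil>\<tau> * Suc n\<rceil> - 1) / Suc n < \<tau>"
      by (simp_all only: less_divide_eq divide_less_eq of_nat_0_less_iff zero_less_Suc if_True less_eq_real_def simp_thms)
  qed
  then show ?thesis using \<tau> unfolding left_level_def
    by (auto intro!: exI[of _ N]) (metis max.cobounded1 max.cobounded2)
qed

end

section \<open>Verification\<close>

locale controlled_value =
  deterioration_model \<xi> smax lam f r c + controlled_system M F \<xi> smax f lam x t s X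
  for \<xi> smax lam f r c and M :: "'w measure" and F x t s X +
  fixes V :: "nat \<Rightarrow> real \<Rightarrow> real"
  assumes V: "hjb_solution t V" and t: "0 \<le> t" and x: "x \<le> \<xi>"
begin

sublocale subfiltration M F t using t by (rule subfiltration)

definition regular :: "'w \<Rightarrow> bool" where
  "regular \<omega> \<longleftrightarrow> \<omega> \<in> space M \<and> unit_jump_path t (\<lambda>\<tau>. X \<tau> \<omega>) \<and> X 0 \<omega> = x \<and>
     (\<forall>\<tau>\<in>{0..t}. X \<tau> \<omega> \<le> \<xi>) \<and> (\<forall>\<tau>\<in>{0..t}. X \<tau> \<omega> = \<xi> \<longrightarrow> s \<tau> \<omega> = 0)"

lemma AE_regular: "AE \<omega> in M. regular \<omega>"
  unfolding regular_def
  using level_paths level_initial level_bounded off_at_failure by (auto elim: AE_mp simp: AE_conj_iff)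

abbreviation jumps :: "'w \<Rightarrow> real set" where
  "jumps \<omega> \<equiv> jump_times t (\<lambda>\<tau>. X \<tau> \<omega>)"

text \<open>This is \<open>h\<close> at the left limit of the level, written as a finite sum so that
  measurability is inherited from \<open>left_level\<close>. Left limits from \<open>m\<close> on
  contribute 0: \<open>m\<close> is \<open>\<xi>\<close> for the marginal values, since no jump
  leaves \<open>\<xi>\<close>, and \<open>Suc \<xi>\<close> for \<open>value_rate\<close>, which is
  defined at \<open>\<xi>\<close> too.\<close>

definition before_jump :: "nat \<Rightarrow> (nat \<Rightarrow> real \<Rightarrow> real) \<Rightarrow> real \<Rightarrow> 'w \<Rightarrow> real" where
  "before_jump m h \<tau> \<omega> = (\<Sum>y<m. indicator (left_level y) (\<tau>, \<omega>) * (indicator {0..t} \<tau> * h y (t - \<tau>)))"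

text \<open>General in \<open>N\<close> because two sigma-algebras occur: the predictable one for
  \<open>intensity\<close> and the product one for the time integrals.\<close>

lemma before_jump_measurable:
  assumes N: "\<And>y. left_level y \<in> sets N" "fst \<in> borel_measurable N"
    and h: "\<And>y. y < m \<Longrightarrow> continuous_on {0..t} (h y)"
  shows "(\<lambda>p. before_jump m h (fst p) (snd p)) \<in> borel_measurable N"
proof -
  have "(\<lambda>\<tau>. indicator {0..t} \<tau> * h y (t - \<tau>)) \<in> borel_measurable borel" if "y < m" for y
  proof -
    have "continuous_on {0..t} (\<lambda>\<tau>. h y (t - \<tau>))"
      by (rule continuous_on_compose2[OF h[OF that]]) (auto intro!: continuous_intros)
    from borel_measurable_continuous_on_indicator[OF _ this] show ?thesis by simp
  qed
  note g = measurable_compose[OF N(2) this]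
  show ?thesis unfolding before_jump_def prod.collapse
    by (rule borel_measurable_sum, rule borel_measurable_times[OF borel_measurable_indicator[OF N(1)] g]) simp
qed

lemma before_jump_joint_measurable:
  assumes "\<And>y. y < m \<Longrightarrow> continuous_on {0..t} (h y)"
  shows "case_prod (before_jump m h) \<in> borel_measurable (borel \<Otimes>\<^sub>M M)"
  unfolding case_prod_beta'
  by (rule before_jump_measurable) (use left_level_predictable[OF t] predictable_sets_joint assms in auto)

lemma before_jump_bounded:
  assumes h: "\<And>y. y < m \<Longrightarrow> continuous_on {0..t} (h y)"
  obtains B where "\<And>\<tau> \<omega>. \<bar>before_jump m h \<tau> \<omega>\<bar> \<le> B"
proof -
  have "\<exists>B. \<forall>k\<in>{0..t}. \<bar>h y k\<bar> \<le> B" if "y < m" for y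
  proof -
    have "bounded (h y ` {0..t})" using h[OF that] by (intro compact_imp_bounded compact_continuous_image) auto
    then show ?thesis by (auto simp: bounded_real)
  qed
  then obtain B where B: "\<And>y k. y < m \<Longrightarrow> k \<in> {0..t} \<Longrightarrow> \<bar>h y k\<bar> \<le> B y" by metis
  have "\<bar>before_jump m h \<tau> \<omega>\<bar> \<le> (\<Sum>y<m. \<bar>B y\<bar>)" for \<tau> \<omega>
    unfolding before_jump_def
  proof (rule order_trans[OF sum_abs sum_mono])
    fix y assume y: "y \<in> {..<m}"
    show "\<bar>indicator (left_level y) (\<tau>, \<omega>) * (indicator {0..t} \<tau> * h y (t - \<tau>))\<bar> \<le> \<bar>B y\<bar>"
    proof (cases "\<tau> \<in> {0..t}")
      case True
      then have "\<bar>h y (t - \<tau>)\<bar> \<le> B y" using y by (intro B) auto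
      then show ?thesis by (auto simp: indicator_def)
    qed auto
  qed
  then show ?thesis using that by blast
qed

lemma before_jump_eq:
  assumes reg: "regular \<omega>" and \<tau>: "0 < \<tau>" "\<tau> \<le> t"
  obtains l where "X \<tau> \<omega> = (if \<tau> \<in> jumps \<omega> then Suc l else l)"
    "\<And>m h. before_jump m h \<tau> \<omega> = (if l < m then h l (t - \<tau>) else 0)"
proof -
  have path: "unit_jump_path t (\<lambda>\<tau>. X \<tau> \<omega>)" and sp: "\<omega> \<in> space M" using reg by (auto simp: regular_def)
  obtain l b where l: "0 \<le> b" "b < \<tau>" "\<And>u. b < u \<Longrightarrow> u < \<tau> \<Longrightarrow> X u \<omega> = l"
    "X \<tau> \<omega> = (if \<tau> \<in> jumps \<omega> then Suc l else l)"
    using unit_jump_path_left_limit[OF path \<tau>] by metis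
  have "before_jump m h \<tau> \<omega> = (\<Sum>y<m. if y = l then h l (t - \<tau>) else 0)" for m h
    unfolding before_jump_def using left_level_iff[OF \<tau> sp l(1-3)] \<tau>
    by (intro sum.cong) (auto simp: indicator_def)
  then show ?thesis using that l(4) by auto
qed

abbreviation marginal :: "nat \<Rightarrow> real \<Rightarrow> real" where
  "marginal y k \<equiv> V y k - V (Suc y) k"

lemma marginal_cont: "y < \<xi> \<Longrightarrow> continuous_on {0..t} (marginal y)"
  using V_cont[OF t V] by (intro continuous_on_diff) auto

lemma rate_cont: "y < Suc \<xi> \<Longrightarrow> continuous_on {0..t} (value_rate V y)"
  using value_rate_cont[OF t V] by simp

lemma before_jump_marginal_nonneg: "0 \<le> before_jump \<xi> marginal \<tau> \<omega>"
proof (cases "\<tau> \<in> {0..t}")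
  case True
  then show ?thesis unfolding before_jump_def
    using marginal_nonneg[OF t V, of _ "t - \<tau>"] by (intro sum_nonneg mult_nonneg_nonneg) auto
qed (simp add: before_jump_def)

lemma reversed_deriv:
  assumes "y \<le> \<xi>" "\<tau> \<in> {0..t}"
  shows "((\<lambda>\<tau>. V y (t - \<tau>)) has_real_derivative - value_rate V y (t - \<tau>)) (at \<tau> within {0..t})"
proof -
  have "(V y has_real_derivative value_rate V y (t - \<tau>)) (at (t - \<tau>) within (\<lambda>\<tau>. t - \<tau>) ` {0..t})"
    using V_deriv[OF t V, of y "t - \<tau>"] assms by (simp add: image_diff_atLeastAtMost)
  moreover have "((\<lambda>\<tau>. t - \<tau>) has_real_derivative - 1) (at \<tau> within {0..t})"
    by (auto intro!: derivative_eq_intros)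
  ultimately have "(V y \<circ> (\<lambda>\<tau>. t - \<tau>) has_real_derivative value_rate V y (t - \<tau>) * - 1) (at \<tau> within {0..t})"
    by (rule DERIV_image_chain)
  then show ?thesis by (simp add: comp_def)
qed

text \<open>Change of variables for \<open>V (X \<tau> \<omega>) (t - \<tau>)\<close>, which runs
  from \<open>V x t\<close> to \<open>- c (X t \<omega>)\<close> and loses the marginal value of the
  level left at each jump. In the time integral the level may be replaced by its left limit, as they
  differ at finitely many times only.\<close>

lemma sum_marginal_jumps:
  assumes reg: "regular \<omega>"
  shows "finite (jumps \<omega>)"
    and "(\<Sum>\<tau>\<in>jumps \<omega>. before_jump \<xi> marginal \<tau> \<omega>) =
      V x t + c (X t \<omega>) - (LINT \<tau>:{0..t}|lborel. before_jump (Suc \<xi>) (value_rate V) \<tau> \<omega>)"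
proof -
  have path: "unit_jump_path t (\<lambda>\<tau>. X \<tau> \<omega>)" and sp: "\<omega> \<in> space M" and x0: "X 0 \<omega> = x"
    and le: "\<And>\<tau>. \<tau> \<in> {0..t} \<Longrightarrow> X \<tau> \<omega> \<le> \<xi>" using reg by (auto simp: regular_def)
  let ?\<rho> = "before_jump (Suc \<xi>) (value_rate V)" and ?\<delta> = "before_jump \<xi> marginal"
  have "finite (jumps \<omega>) \<and>
    ((\<lambda>\<tau>. - value_rate V (X \<tau> \<omega>) (t - \<tau>)) has_integral
      V (X t \<omega>) (t - t) - V (X 0 \<omega>) (t - 0) -
      (\<Sum>\<tau>\<in>jumps \<omega>. V (X \<tau> \<omega>) (t - \<tau>) - V (X \<tau> \<omega> - 1) (t - \<tau>))) {0..t}"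
    using le t by (intro path_change_of_variables[OF path t _ reversed_deriv]) auto
  then have fin: "finite (jumps \<omega>)" and int: "((\<lambda>\<tau>. - value_rate V (X \<tau> \<omega>) (t - \<tau>)) has_integral
      - c (X t \<omega>) - V x t - (\<Sum>\<tau>\<in>jumps \<omega>. V (X \<tau> \<omega>) (t - \<tau>) - V (X \<tau> \<omega> - 1) (t - \<tau>))) {0..t}"
    using V_0[OF t V le[of t]] t x0 by auto
  have sum_eq: "(\<Sum>\<tau>\<in>jumps \<omega>. V (X \<tau> \<omega>) (t - \<tau>) - V (X \<tau> \<omega> - 1) (t - \<tau>)) = - (\<Sum>\<tau>\<in>jumps \<omega>. ?\<delta> \<tau> \<omega>)"
    unfolding sum_negf[symmetric]
  proof (rule sum.cong[OF refl])
    fix \<tau> assume \<tau>J: "\<tau> \<in> jumps \<omega>"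
    then have \<tau>: "0 < \<tau>" "\<tau> \<le> t" by (auto simp: mem_jump_times_iff)
    obtain l where l: "X \<tau> \<omega> = Suc l" "\<And>m h. before_jump m h \<tau> \<omega> = (if l < m then h l (t - \<tau>) else 0)"
      using before_jump_eq[OF reg \<tau>] \<tau>J by metis
    then show "V (X \<tau> \<omega>) (t - \<tau>) - V (X \<tau> \<omega> - 1) (t - \<tau>) = - ?\<delta> \<tau> \<omega>"
      using le[of \<tau>] \<tau> by simp
  qed
  have "((\<lambda>\<tau>. value_rate V (X \<tau> \<omega>) (t - \<tau>)) has_integral
      V x t + c (X t \<omega>) - (\<Sum>\<tau>\<in>jumps \<omega>. ?\<delta> \<tau> \<omega>)) {0..t}"
    using has_integral_neg[OF int[unfolded sum_eq]] by (simp add: algebra_simps)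
  then have "((\<lambda>\<tau>. ?\<rho> \<tau> \<omega>) has_integral V x t + c (X t \<omega>) - (\<Sum>\<tau>\<in>jumps \<omega>. ?\<delta> \<tau> \<omega>)) {0..t}"
  proof (rule has_integral_spike_finite[rotated 2])
    show "finite (insert 0 (jumps \<omega>))" using fin by simp
    fix \<tau> assume "\<tau> \<in> {0..t} - insert 0 (jumps \<omega>)"
    then have \<tau>: "0 < \<tau>" "\<tau> \<le> t" "\<tau> \<notin> jumps \<omega>" by auto
    then show "?\<rho> \<tau> \<omega> = value_rate V (X \<tau> \<omega>) (t - \<tau>)"
      using before_jump_eq[OF reg \<tau>(1,2)] le[of \<tau>] by (metis atLeastAtMost_iff less_Suc_eq_le less_imp_le)
  qed
  moreover have "set_integrable lborel {0..t} (\<lambda>\<tau>. ?\<rho> \<tau> \<omega>)"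
  proof -
    obtain B where "\<And>\<tau> \<omega>. \<bar>?\<rho> \<tau> \<omega>\<bar> \<le> B" using before_jump_bounded[of "Suc \<xi>" "value_rate V", OF rate_cont] by blast
    then show ?thesis
      by (intro time_section_integrable[OF before_jump_joint_measurable[of "Suc \<xi>" "value_rate V", OF rate_cont] _ sp])
  qed
  ultimately have "(LINT \<tau>:{0..t}|lborel. ?\<rho> \<tau> \<omega>) = V x t + c (X t \<omega>) - (\<Sum>\<tau>\<in>jumps \<omega>. ?\<delta> \<tau> \<omega>)"
    by (simp add: set_borel_integral_eq_integral(2) integral_unique)
  then show "finite (jumps \<omega>)" "(\<Sum>\<tau>\<in>jumps \<omega>. ?\<delta> \<tau> \<omega>) =
      V x t + c (X t \<omega>) - (LINT \<tau>:{0..t}|lborel. ?\<rho> \<tau> \<omega>)" using fin by auto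
qed


text \<open>The amount by which the rate in force misses the maximum in the HJB equation. Left
  limits and indicators make it jointly measurable; \<open>slack_eq\<close> recovers the familiar
  form away from jumps.\<close>

definition slack :: "real \<Rightarrow> 'w \<Rightarrow> real" where
  "slack \<tau> \<omega> = before_jump (Suc \<xi>) (value_rate V) \<tau> \<omega>
      + before_jump \<xi> marginal \<tau> \<omega> * (indicator {0..t} \<tau> * (lam * f (s \<tau> \<omega>)))
      - indicator {0..t} \<tau> * r (s \<tau> \<omega>)"

text \<open>Take expectations in \<open>sum_marginal_jumps\<close>; \<open>intensity\<close> turns
  the jump sum into the time integral of the marginal value times
  \<open>lam * f (s \<tau> \<omega>)\<close>. The uniform bounds serve to split the expectations and
  to pass from \<open>ennreal\<close> back to real integrals.\<close>

lemma expected_profit_eq: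
  "expected_profit r c t M s X = V x t - (\<integral>\<omega>. (LINT \<tau>:{0..t}|lborel. slack \<tau> \<omega>) \<partial>M)"
proof -
  let ?\<rho> = "before_jump (Suc \<xi>) (value_rate V)" and ?\<delta> = "before_jump \<xi> marginal"
  let ?\<kappa> = "\<lambda>\<tau> \<omega>. indicator {0..t} \<tau> * (lam * f (s \<tau> \<omega>))"
  let ?r = "\<lambda>\<tau> \<omega>. indicator {0..t} \<tau> * r (s \<tau> \<omega>)"
  let ?I = "\<lambda>h \<omega>. LINT \<tau>:{0..t}|lborel. h \<tau> \<omega>"
  have \<rho>_meas: "case_prod ?\<rho> \<in> borel_measurable (borel \<Otimes>\<^sub>M M)" by (rule before_jump_joint_measurable[of "Suc \<xi>" "value_rate V", OF rate_cont])
  have \<delta>_meas: "case_prod ?\<delta> \<in> borel_measurable (borel \<Otimes>\<^sub>M M)" by (rule before_jump_joint_measurable[of \<xi> marginal, OF marginal_cont])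
  have \<kappa>_meas: "case_prod ?\<kappa> \<in> borel_measurable (borel \<Otimes>\<^sub>M M)"
    by (rule rate_joint_measurable[OF t]) (intro continuous_intros f_cont)
  have r_meas: "case_prod ?r \<in> borel_measurable (borel \<Otimes>\<^sub>M M)"
    by (rule rate_joint_measurable[OF t r_cont])
  have \<delta>\<kappa>_meas: "(\<lambda>(\<tau>, \<omega>). ?\<delta> \<tau> \<omega> * ?\<kappa> \<tau> \<omega>) \<in> borel_measurable (borel \<Otimes>\<^sub>M M)"
    using borel_measurable_times[OF \<delta>_meas \<kappa>_meas] by (simp add: case_prod_beta')
  have f_range: "0 \<le> lam * f (s \<tau> \<omega>)" "lam * f (s \<tau> \<omega>) \<le> lam * f smax" if "\<tau> \<in> {0..t}" "\<omega> \<in> space M" for \<tau> \<omega>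
    using f_nonneg[OF rate_range[OF that]] f_le[OF rate_range[OF that]] lam_nonneg by (auto intro: mult_left_mono)
  obtain B\<rho> where B\<rho>: "\<And>\<tau> \<omega>. \<bar>?\<rho> \<tau> \<omega>\<bar> \<le> B\<rho>" using before_jump_bounded[of "Suc \<xi>" "value_rate V", OF rate_cont] by blast
  obtain B\<delta> where B\<delta>: "\<And>\<tau> \<omega>. \<bar>?\<delta> \<tau> \<omega>\<bar> \<le> B\<delta>" using before_jump_bounded[of \<xi> marginal, OF marginal_cont] by blast
  have B\<delta>\<kappa>: "\<bar>?\<delta> \<tau> \<omega> * ?\<kappa> \<tau> \<omega>\<bar> \<le> B\<delta> * (lam * f smax)" if "\<tau> \<in> {0..t}" "\<omega> \<in> space M" for \<tau> \<omega>
  proof -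
    have "\<bar>?\<delta> \<tau> \<omega>\<bar> * (lam * f (s \<tau> \<omega>)) \<le> B\<delta> * (lam * f smax)"
      by (rule mult_mono) (use f_range[OF that] B\<delta>[of \<tau> \<omega>] in auto)
    moreover have "?\<kappa> \<tau> \<omega> = lam * f (s \<tau> \<omega>)" using that(1) by simp
    ultimately show ?thesis using f_range(1)[OF that] by (simp only: abs_mult[of "?\<delta> \<tau> \<omega>"] abs_of_nonneg)
  qed
  have Br: "\<bar>?r \<tau> \<omega>\<bar> \<le> max \<bar>r 0\<bar> \<bar>r smax\<bar>" if "\<tau> \<in> {0..t}" "\<omega> \<in> space M" for \<tau> \<omega>
    using rate_range[OF that] mono_onD[OF r_mono, of 0 "s \<tau> \<omega>"] mono_onD[OF r_mono, of "s \<tau> \<omega>" smax] that(1)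
    by auto
  have \<rho>_si: "set_integrable lborel {0..t} (\<lambda>\<tau>. ?\<rho> \<tau> \<omega>)"
    and \<delta>\<kappa>_si: "set_integrable lborel {0..t} (\<lambda>\<tau>. ?\<delta> \<tau> \<omega> * ?\<kappa> \<tau> \<omega>)"
    and r_si: "set_integrable lborel {0..t} (\<lambda>\<tau>. ?r \<tau> \<omega>)" if "\<omega> \<in> space M" for \<omega>
    by (rule time_section_integrable[OF \<rho>_meas B\<rho> that]
        time_section_integrable[OF \<delta>\<kappa>_meas B\<delta>\<kappa> that] time_section_integrable[OF r_meas Br that]; assumption)+
  have \<rho>_int: "integrable M (?I ?\<rho>)" and \<delta>\<kappa>_int: "integrable M (?I (\<lambda>\<tau> \<omega>. ?\<delta> \<tau> \<omega> * ?\<kappa> \<tau> \<omega>))"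
    and r_int: "integrable M (?I ?r)"
    by (rule time_integral_integrable(2)[OF \<rho>_meas B\<rho>] time_integral_integrable(2)[OF \<delta>\<kappa>_meas B\<delta>\<kappa>]
        time_integral_integrable(2)[OF r_meas Br]; assumption)+
  have c_int: "integrable M (\<lambda>\<omega>. c (X t \<omega>))"
  proof (rule integrable_const_bound[where B="\<Sum>y\<le>\<xi>. \<bar>c y\<bar>"])
    show "AE \<omega> in M. norm (c (X t \<omega>)) \<le> (\<Sum>y\<le>\<xi>. \<bar>c y\<bar>)"
      using level_bounded
    proof eventually_elim
      case (elim \<omega>)
      then show ?case using t member_le_sum[of "X t \<omega>" "{..\<xi>}" "\<lambda>y. \<bar>c y\<bar>"] by auto
    qed
    have "X t \<in> M \<rightarrow>\<^sub>M count_space UNIV"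
      using level_adapted[of t] t subalgebra[of t] by (auto intro: measurable_from_subalg)
    then show "(\<lambda>\<omega>. c (X t \<omega>)) \<in> borel_measurable M" by measurable
  qed
  \<comment> \<open>Almost surely \<open>A\<close> is the jump sum of the marginal values, in a form
    whose integrability is evident.\<close>
  define A where "A \<omega> = V x t + c (X t \<omega>) - ?I ?\<rho> \<omega>" for \<omega>
  have A_int: "integrable M A" unfolding A_def using c_int \<rho>_int by simp
  have "(\<integral>\<^sup>+\<omega>. ennreal (A \<omega>) \<partial>M) = (\<integral>\<^sup>+\<omega>. (\<Sum>\<tau>\<in>jumps \<omega>. ennreal (?\<delta> \<tau> \<omega>)) \<partial>M)"
  proof (rule nn_integral_cong_AE)
    show "AE \<omega> in M. ennreal (A \<omega>) = (\<Sum>\<tau>\<in>jumps \<omega>. ennreal (?\<delta> \<tau> \<omega>))"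
      using AE_regular
    proof eventually_elim
      case (elim \<omega>)
      then show ?case using sum_marginal_jumps[OF elim] before_jump_marginal_nonneg
        by (simp add: A_def sum_ennreal)
    qed
  qed
  also have "\<dots> = (\<integral>\<^sup>+\<omega>. (\<integral>\<^sup>+\<tau>\<in>{0..t}. ennreal (?\<delta> \<tau> \<omega>) * ennreal (lam * f (s \<tau> \<omega>)) \<partial>lborel) \<partial>M)"
  proof -
    \<comment> \<open>The left limit pays off here: with the level itself the integrand would not be
      predictable.\<close>
    have "(\<lambda>p. ennreal (?\<delta> (fst p) (snd p))) \<in> borel_measurable pred_sigma"
      by (intro measurable_compose[OF _ measurable_ennreal] before_jump_measurable marginal_cont
          left_level_predictable[OF t] fst_predictable)
    from intensity[OF this] show ?thesis by simp
  qed
  also have "\<dots> = (\<integral>\<^sup>+\<omega>. ennreal (?I (\<lambda>\<tau> \<omega>. ?\<delta> \<tau> \<omega> * ?\<kappa> \<tau> \<omega>) \<omega>) \<partial>M)"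
  proof (rule nn_integral_cong)
    fix \<omega> assume \<omega>: "\<omega> \<in> space M"
    have "(\<integral>\<^sup>+\<tau>\<in>{0..t}. ennreal (?\<delta> \<tau> \<omega>) * ennreal (lam * f (s \<tau> \<omega>)) \<partial>lborel)
      = (\<integral>\<^sup>+\<tau>. ennreal (indicator {0..t} \<tau> *\<^sub>R (?\<delta> \<tau> \<omega> * ?\<kappa> \<tau> \<omega>)) \<partial>lborel)"
      using before_jump_marginal_nonneg f_range[OF _ \<omega>]
      by (intro nn_integral_cong) (auto simp: indicator_def ennreal_mult)
    also have "\<dots> = ennreal (?I (\<lambda>\<tau> \<omega>. ?\<delta> \<tau> \<omega> * ?\<kappa> \<tau> \<omega>) \<omega>)"
      unfolding set_lebesgue_integral_def
      using \<delta>\<kappa>_si[OF \<omega>] before_jump_marginal_nonneg f_range[OF _ \<omega>]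
      by (intro nn_integral_eq_integral) (auto simp: set_integrable_def indicator_def)
    finally show "(\<integral>\<^sup>+\<tau>\<in>{0..t}. ennreal (?\<delta> \<tau> \<omega>) * ennreal (lam * f (s \<tau> \<omega>)) \<partial>lborel)
      = ennreal (?I (\<lambda>\<tau> \<omega>. ?\<delta> \<tau> \<omega> * ?\<kappa> \<tau> \<omega>) \<omega>)" .
  qed
  finally have nn: "(\<integral>\<^sup>+\<omega>. ennreal (A \<omega>) \<partial>M) = (\<integral>\<^sup>+\<omega>. ennreal (?I (\<lambda>\<tau> \<omega>. ?\<delta> \<tau> \<omega> * ?\<kappa> \<tau> \<omega>) \<omega>) \<partial>M)" .
  have A_nn: "AE \<omega> in M. 0 \<le> A \<omega>"
    using AE_regular
  proof eventually_elim
    case (elim \<omega>)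
    then show ?case using sum_marginal_jumps[OF elim] before_jump_marginal_nonneg
      by (simp add: A_def flip: sum_marginal_jumps(2)) (metis sum_nonneg)
  qed
  have I_nn: "AE \<omega> in M. 0 \<le> ?I (\<lambda>\<tau> \<omega>. ?\<delta> \<tau> \<omega> * ?\<kappa> \<tau> \<omega>) \<omega>"
    unfolding set_lebesgue_integral_def
    using before_jump_marginal_nonneg f_range by (auto intro!: AE_I2 integral_nonneg_AE simp: indicator_def)
  have "ennreal (\<integral>\<omega>. A \<omega> \<partial>M) = ennreal (\<integral>\<omega>. ?I (\<lambda>\<tau> \<omega>. ?\<delta> \<tau> \<omega> * ?\<kappa> \<tau> \<omega>) \<omega> \<partial>M)"
    using nn nn_integral_eq_integral[OF A_int A_nn] nn_integral_eq_integral[OF \<delta>\<kappa>_int I_nn] by simp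
  then have key: "(\<integral>\<omega>. A \<omega> \<partial>M) = (\<integral>\<omega>. ?I (\<lambda>\<tau> \<omega>. ?\<delta> \<tau> \<omega> * ?\<kappa> \<tau> \<omega>) \<omega> \<partial>M)"
    using integral_nonneg_AE[OF A_nn] integral_nonneg_AE[OF I_nn] by simp
  have "(\<integral>\<omega>. A \<omega> \<partial>M) = V x t + (\<integral>\<omega>. c (X t \<omega>) \<partial>M) - (\<integral>\<omega>. ?I ?\<rho> \<omega> \<partial>M)"
    unfolding A_def using c_int \<rho>_int by (simp add: prob_space)
  moreover have "(\<integral>\<omega>. ?I slack \<omega> \<partial>M) = (\<integral>\<omega>. ?I ?\<rho> \<omega> + ?I (\<lambda>\<tau> \<omega>. ?\<delta> \<tau> \<omega> * ?\<kappa> \<tau> \<omega>) \<omega> - ?I ?r \<omega> \<partial>M)"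
    unfolding slack_def using \<rho>_si \<delta>\<kappa>_si r_si
    by (intro Bochner_Integration.integral_cong) (simp_all add: set_integral_diff set_integral_add)
  moreover have "\<dots> = (\<integral>\<omega>. ?I ?\<rho> \<omega> \<partial>M) + (\<integral>\<omega>. ?I (\<lambda>\<tau> \<omega>. ?\<delta> \<tau> \<omega> * ?\<kappa> \<tau> \<omega>) \<omega> \<partial>M) - (\<integral>\<omega>. ?I ?r \<omega> \<partial>M)"
    using \<rho>_int \<delta>\<kappa>_int r_int by simp
  moreover have "expected_profit r c t M s X = (\<integral>\<omega>. ?I ?r \<omega> \<partial>M) - (\<integral>\<omega>. c (X t \<omega>) \<partial>M)"
  proof -
    have "(LINT \<tau>:{0..t}|lborel. r (s \<tau> \<omega>)) = ?I ?r \<omega>" for \<omega>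
      by (rule set_lebesgue_integral_cong) auto
    then show ?thesis unfolding expected_profit_def using r_int c_int by simp
  qed
  ultimately show ?thesis using key by simp
qed

text \<open>Off the jump times the left limit is the level. At \<open>\<xi>\<close> the system is
  off and no marginal term is present, so \<open>value_rate\<close>, which is \<open>r 0\<close>
  there, cancels the revenue.\<close>

lemma slack_eq:
  assumes reg: "regular \<omega>" and \<tau>: "0 < \<tau>" "\<tau> \<le> t" "\<tau> \<notin> jumps \<omega>"
  shows "slack \<tau> \<omega> =
    (if X \<tau> \<omega> < \<xi> then ham (marginal (X \<tau> \<omega>) (t - \<tau>)) - (r (s \<tau> \<omega>) - lam * f (s \<tau> \<omega>) * marginal (X \<tau> \<omega>) (t - \<tau>)) else 0)"
proof -
  obtain l where l: "X \<tau> \<omega> = l" "\<And>m h. before_jump m h \<tau> \<omega> = (if l < m then h l (t - \<tau>) else 0)"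
    using before_jump_eq[OF reg \<tau>(1,2)] \<tau>(3) by metis
  have "l \<le> \<xi>" "l = \<xi> \<Longrightarrow> s \<tau> \<omega> = 0" using reg \<tau> l(1) by (auto simp: regular_def)
  then show ?thesis using l \<tau> by (auto simp: slack_def value_rate_def algebra_simps)
qed

theorem expected_profit_le: "expected_profit r c t M s X \<le> V x t"
proof -
  have "0 \<le> (\<integral>\<omega>. (LINT \<tau>:{0..t}|lborel. slack \<tau> \<omega>) \<partial>M)"
  proof (rule integral_nonneg_AE)
    show "AE \<omega> in M. 0 \<le> (LINT \<tau>:{0..t}|lborel. slack \<tau> \<omega>)"
      using AE_regular
    proof eventually_elim
      case (elim \<omega>)
      \<comment> \<open>\<open>slack_eq\<close> covers neither time 0, where there is no left limit,
        nor the jump times; together they form a Lebesgue null set.\<close>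
      have "finite (insert 0 (jumps \<omega>))" using sum_marginal_jumps(1)[OF elim] by simp
      then have "AE \<tau> in lborel. \<tau> \<notin> insert 0 (jumps \<omega>)"
        by (intro AE_not_in countable_imp_null_set_lborel countable_finite)
      then have "AE \<tau> in lborel. 0 \<le> indicator {0..t} \<tau> *\<^sub>R slack \<tau> \<omega>"
      proof eventually_elim
        case (elim \<tau>)
        show ?case
        proof (cases "\<tau> \<in> {0..t}")
          case True
          then have "s \<tau> \<omega> \<in> {0..smax}" using \<open>regular \<omega>\<close> by (intro rate_range) (auto simp: regular_def)
          then have "0 \<le> slack \<tau> \<omega>"
            using slack_eq[OF \<open>regular \<omega>\<close>, of \<tau>] elim True gain_le_ham by auto
          then show ?thesis by simp
        qed simp
      qed
      then show ?case unfolding set_lebesgue_integral_def by (rule integral_nonneg_AE)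
    qed
  qed
  then show ?thesis using expected_profit_eq by simp
qed

theorem expected_profit_optimal:
  assumes opt: "\<And>\<tau> \<omega>. \<tau> \<in> {0..t} \<Longrightarrow> \<omega> \<in> space M \<Longrightarrow> X \<tau> \<omega> < \<xi> \<Longrightarrow>
    s \<tau> \<omega> = best_rate (marginal (X \<tau> \<omega>) (t - \<tau>))"
  shows "expected_profit r c t M s X = V x t"
proof -
  have "(\<integral>\<omega>. (LINT \<tau>:{0..t}|lborel. slack \<tau> \<omega>) \<partial>M) = 0"
  proof (rule integral_eq_zero_AE)
    show "AE \<omega> in M. (LINT \<tau>:{0..t}|lborel. slack \<tau> \<omega>) = 0"
      using AE_regular
    proof eventually_elim
      case (elim \<omega>)
      have "finite (insert 0 (jumps \<omega>))" using sum_marginal_jumps(1)[OF elim] by simp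
      then have "AE \<tau> in lborel. \<tau> \<notin> insert 0 (jumps \<omega>)"
        by (intro AE_not_in countable_imp_null_set_lborel countable_finite)
      then have "AE \<tau> in lborel. indicator {0..t} \<tau> *\<^sub>R slack \<tau> \<omega> = 0"
      proof eventually_elim
        case (elim \<tau>)
        show ?case
        proof (cases "\<tau> \<in> {0..t}")
          case True
          then have "slack \<tau> \<omega> = 0"
            using slack_eq[OF \<open>regular \<omega>\<close>, of \<tau>] elim opt[of \<tau> \<omega>] best_rate_ham \<open>regular \<omega>\<close>
            by (auto simp: regular_def)
          then show ?thesis by simp
        qed simp
      qed
      then show ?case unfolding set_lebesgue_integral_def by (rule integral_eq_zero_AE)
    qed
  qed
  then show ?thesis using expected_profit_eq by simp
qed

end

section \<open>Hitting times of a cumulative hazard\<close>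

abbreviation unit_exp :: "real measure" where
  "unit_exp \<equiv> density lborel (exponential_density 1)"

lemma unit_exp_tail: "0 \<le> b \<Longrightarrow> emeasure unit_exp {b<..} = ennreal (exp (- b))"
proof -
  assume b: "0 \<le> b"
  have "emeasure unit_exp {b<..} = (\<integral>\<^sup>+u. ennreal (exponential_density 1 u) * indicator {b<..} u \<partial>lborel)"
    by (simp add: emeasure_density)
  also have "\<dots> = (\<integral>\<^sup>+u. ennreal (exp (- u)) * indicator {b..} u \<partial>lborel)"
    by (rule nn_integral_cong_AE, use AE_lborel_singleton[of b] in eventually_elim)
       (use b in \<open>auto simp: exponential_density_def indicator_def\<close>)
  also have "\<dots> = ennreal (0 - (- exp (- b)))"
    by (rule nn_integral_FTC_atLeast) (auto intro!: derivative_eq_intros, real_asymp)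
  finally show ?thesis by simp
qed

text \<open>Lack of memory: given that \<open>v\<close> exceeds \<open>b\<close>, the excess is
  again unit exponential with mean 1, so the expected excess is the tail probability. This agreement
  with \<open>unit_exp_tail\<close> is the source of the intensity identity.\<close>

lemma unit_exp_excess:
  "0 \<le> b \<Longrightarrow> (\<integral>\<^sup>+v. ennreal (max 0 (v - b)) \<partial>unit_exp) = ennreal (exp (- b))"
proof -
  assume b: "0 \<le> b"
  have "(\<integral>\<^sup>+v. ennreal (max 0 (v - b)) \<partial>unit_exp)
      = (\<integral>\<^sup>+v. ennreal (exponential_density 1 v) * ennreal (max 0 (v - b)) \<partial>lborel)"
    by (rule nn_integral_density) auto
  also have "\<dots> = (\<integral>\<^sup>+v. ennreal ((v - b) * exp (- v)) * indicator {b..} v \<partial>lborel)"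
    using b by (intro nn_integral_cong)
      (auto simp: exponential_density_def indicator_def max_def ennreal_mult'[symmetric] mult.commute)
  also have "\<dots> = ennreal (0 - (- (b - b + 1) * exp (- b)))"
    by (rule nn_integral_FTC_atLeast[where F="\<lambda>v. - (v - b + 1) * exp (- v)"])
       (auto intro!: derivative_eq_intros simp: algebra_simps, real_asymp)
  finally show ?thesis by simp
qed

lemma unit_exp_AE_pos: "AE v in unit_exp. 0 < v"
proof -
  have "AE v in lborel. v \<noteq> (0::real)" by (rule AE_lborel_singleton)
  then have "AE v in lborel. 0 < ennreal (exponential_density 1 v) \<longrightarrow> 0 < v"
    by eventually_elim (auto simp: exponential_density_def)
  then show ?thesis by (subst AE_density) auto
qed

text \<open>
  The rate \<open>1\<close> beyond the horizon only makes the cumulative hazard unbounded, so that every level is hit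
  in finite time.
\<close>

locale hazard_rate =
  fixes a :: "real \<Rightarrow> real" and K t :: real
  assumes a_measurable [measurable]: "a \<in> borel_measurable borel"
    and a_nonneg: "\<And>u. 0 \<le> a u" and a_le: "\<And>u. a u \<le> K"
    and a_late: "\<And>u. t < u \<Longrightarrow> a u = 1" and t: "0 \<le> t"
begin

definition cum :: "real \<Rightarrow> real" where
  "cum \<tau> = (LINT u:{0<..\<tau>}|lborel. a u)"

lemma K_nonneg: "0 \<le> K" using a_nonneg a_le order_trans by blast

lemma a_integrable: "A \<in> sets borel \<Longrightarrow> A \<subseteq> {p..q} \<Longrightarrow> set_integrable lborel A a"
proof (rule set_integrable_subset[of lborel "{p..q}"])
  show "set_integrable lborel {p..q} a"
    unfolding set_integrable_def
    by (rule integrableI_bounded_set_indicator[where B=K])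
       (use a_nonneg a_le in \<open>auto simp: emeasure_lborel_Icc_eq\<close>)
qed auto

lemma a_integrable_Ioc: "set_integrable lborel {\<sigma><..\<tau>} a"
  by (rule a_integrable[of _ \<sigma> \<tau>]) auto

lemma cum_diff:
  assumes "0 \<le> \<sigma>" "\<sigma> \<le> \<tau>"
  shows "cum \<tau> - cum \<sigma> = (LINT u:{\<sigma><..\<tau>}|lborel. a u)"
proof -
  have "{0<..\<tau>} = {0<..\<sigma>} \<union> {\<sigma><..\<tau>}" using assms by auto
  then have "cum \<tau> = cum \<sigma> + (LINT u:{\<sigma><..\<tau>}|lborel. a u)"
    unfolding cum_def using assms
    by (simp only:) (rule set_integral_Un, auto intro!: a_integrable[of _ 0 \<tau>])
  then show ?thesis by simp
qed

lemma cum_neg: "\<tau> \<le> 0 \<Longrightarrow> cum \<tau> = 0"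
  unfolding cum_def by (simp add: set_lebesgue_integral_def)

lemma set_integral_a_bounds:
  assumes "\<sigma> \<le> \<tau>"
  shows "0 \<le> (LINT u:{\<sigma><..\<tau>}|lborel. a u)" "(LINT u:{\<sigma><..\<tau>}|lborel. a u) \<le> K * (\<tau> - \<sigma>)"
proof -
  show "0 \<le> (LINT u:{\<sigma><..\<tau>}|lborel. a u)"
    unfolding set_lebesgue_integral_def by (rule integral_nonneg_AE) (use a_nonneg in auto)
  have "(LINT u:{\<sigma><..\<tau>}|lborel. a u) \<le> (LINT u:{\<sigma><..\<tau>}|lborel. K)"
    by (rule set_integral_mono[OF a_integrable_Ioc]) (use a_le assms in \<open>auto simp: set_integrable_def\<close>)
  also have "\<dots> = K * (\<tau> - \<sigma>)" using assms by (simp add: set_lebesgue_integral_def)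
  finally show "(LINT u:{\<sigma><..\<tau>}|lborel. a u) \<le> K * (\<tau> - \<sigma>)" .
qed

lemma cum_bounds:
  assumes "\<sigma> \<le> \<tau>"
  shows "cum \<sigma> \<le> cum \<tau>" "cum \<tau> - cum \<sigma> \<le> K * (\<tau> - \<sigma>)"
proof -
  have *: "cum \<sigma> \<le> cum \<tau>" "cum \<tau> - cum \<sigma> \<le> K * (\<tau> - \<sigma>)" if "0 \<le> \<sigma>" "\<sigma> \<le> \<tau>" for \<sigma> \<tau>
    using set_integral_a_bounds[OF that(2)] cum_diff[OF that] by auto
  have c0: "cum (max 0 u) = cum u" for u using cum_neg[of u] cum_neg[of 0] by (simp add: max_def)
  show "cum \<sigma> \<le> cum \<tau>" using *(1)[of "max 0 \<sigma>" "max 0 \<tau>"] assms c0 by auto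
  have "cum \<tau> - cum \<sigma> \<le> K * (max 0 \<tau> - max 0 \<sigma>)" using *(2)[of "max 0 \<sigma>" "max 0 \<tau>"] assms c0 by auto
  also have "\<dots> \<le> K * (\<tau> - \<sigma>)" using assms K_nonneg by (intro mult_left_mono) auto
  finally show "cum \<tau> - cum \<sigma> \<le> K * (\<tau> - \<sigma>)" .
qed

lemma cum_cont: "continuous_on UNIV cum"
proof (rule lipschitz_on_continuous_on)
  show "K-lipschitz_on UNIV cum"
  proof (rule lipschitz_onI)
    fix \<sigma> \<tau> :: real
    show "dist (cum \<sigma>) (cum \<tau>) \<le> K * dist \<sigma> \<tau>"
      using cum_bounds[of \<sigma> \<tau>] cum_bounds[of \<tau> \<sigma>] by (cases "\<sigma> \<le> \<tau>") (auto simp: dist_real_def)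
  qed (rule K_nonneg)
qed

lemma cum_measurable [measurable]: "cum \<in> borel_measurable borel"
  by (rule borel_measurable_continuous_onI[OF cum_cont])

lemma cum_late: "t \<le> \<tau> \<Longrightarrow> \<tau> - t \<le> cum \<tau>"
proof -
  assume \<tau>: "t \<le> \<tau>"
  have "cum \<tau> - cum t = (LINT u:{t<..\<tau>}|lborel. a u)" using t \<tau> by (rule cum_diff)
  also have "\<dots> = (LINT u:{t<..\<tau>}|lborel. 1)"
    by (rule set_lebesgue_integral_cong) (auto simp: a_late)
  also have "\<dots> = \<tau> - t" using \<tau> by (simp add: set_lebesgue_integral_def)
  finally show ?thesis using cum_bounds(1)[of 0 t] cum_neg[of 0] t by simp
qed

text \<open>Generalized inverse of the cumulative hazard restarted at \<sigma>: a budget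
  \<open>v\<close> is consumed at speed \<open>a\<close> from \<sigma> on, and
  \<open>hit \<sigma> v\<close> is the time at which it is used up.\<close>

definition hit :: "real \<Rightarrow> real \<Rightarrow> real" where
  "hit \<sigma> v = Inf {\<tau>. \<sigma> \<le> \<tau> \<and> v + cum \<sigma> \<le> cum \<tau>}"

text \<open>Continuity of \<open>cum\<close> makes the infimum attained. Order properties and
  measurability of \<open>hit\<close> are read off from this equivalence.\<close>

lemma hit_le_iff: "hit \<sigma> v \<le> \<tau> \<longleftrightarrow> \<sigma> \<le> \<tau> \<and> v + cum \<sigma> \<le> cum \<tau>"
proof -
  let ?S = "{\<tau>. \<sigma> \<le> \<tau> \<and> v + cum \<sigma> \<le> cum \<tau>}"
  \<comment> \<open>Past \<open>t\<close> the hazard is 1, so waiting for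
    \<open>\<bar>v + cum \<sigma>\<bar>\<close> beyond \<open>t\<close> accumulates enough.\<close>
  let ?b = "max \<sigma> (t + \<bar>v + cum \<sigma>\<bar>)"
  have "?b - t \<le> cum ?b" by (rule cum_late) auto
  then have ne: "?b \<in> ?S" by auto
  have bdd: "bdd_below ?S" by (rule bdd_belowI[of _ \<sigma>]) auto
  have "closed ?S"
    by (intro closed_Collect_conj closed_Collect_le continuous_intros cum_cont)
  then have "Inf ?S \<in> ?S" using closed_contains_Inf[OF _ bdd] ne by blast
  then have h: "\<sigma> \<le> hit \<sigma> v" "v + cum \<sigma> \<le> cum (hit \<sigma> v)" by (auto simp: hit_def)
  show ?thesis
  proof
    assume "hit \<sigma> v \<le> \<tau>"
    then show "\<sigma> \<le> \<tau> \<and> v + cum \<sigma> \<le> cum \<tau>" using h cum_bounds(1)[of "hit \<sigma> v" \<tau>] by auto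
  next
    assume "\<sigma> \<le> \<tau> \<and> v + cum \<sigma> \<le> cum \<tau>"
    then show "hit \<sigma> v \<le> \<tau>" unfolding hit_def by (intro cInf_lower bdd) auto
  qed
qed

lemma hit_ge: "\<sigma> \<le> hit \<sigma> v" using hit_le_iff[of \<sigma> v "hit \<sigma> v"] by simp

lemma hit_gt: "0 < v \<Longrightarrow> \<sigma> < hit \<sigma> v" using hit_le_iff[of \<sigma> v \<sigma>] by auto

lemma cum_hit:
  assumes "0 \<le> v" shows "cum (hit \<sigma> v) = v + cum \<sigma>"
proof -
  have ge: "v + cum \<sigma> \<le> cum (hit \<sigma> v)" using hit_le_iff[of \<sigma> v "hit \<sigma> v"] by simp
  obtain u where u: "\<sigma> \<le> u" "u \<le> hit \<sigma> v" "cum u = v + cum \<sigma>"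
    using IVT'[of cum \<sigma> "v + cum \<sigma>" "hit \<sigma> v"] ge assms hit_ge continuous_on_subset[OF cum_cont] by auto
  then have "hit \<sigma> v \<le> u" by (simp add: hit_le_iff)
  then show ?thesis using u by simp
qed

lemma hit_measurable [measurable]: "hit \<sigma> \<in> borel_measurable borel"
  by (rule borel_measurableI_le) (simp add: hit_le_iff)

text \<open>At most \<open>K * t\<close> of hazard accumulates within the horizon. Supplies a value
  of the exponential variable for which the next jump comes after the horizon.\<close>

lemma hit_late: "K * t < v \<Longrightarrow> 0 \<le> \<sigma> \<Longrightarrow> t < hit \<sigma> v"
  using hit_le_iff[of \<sigma> v t] cum_bounds[of 0 t] cum_bounds[of 0 \<sigma>] t cum_neg[of 0] by (auto simp: not_le[symmetric])

lemma nn_integral_a: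
  assumes "0 \<le> \<sigma>" "\<sigma> \<le> \<tau>"
  shows "(\<integral>\<^sup>+u. ennreal (a u) * indicator {\<sigma><..\<tau>} u \<partial>lborel) = ennreal (cum \<tau> - cum \<sigma>)"
proof -
  have "(\<integral>\<^sup>+u. ennreal (a u) * indicator {\<sigma><..\<tau>} u \<partial>lborel) = (\<integral>\<^sup>+u. ennreal (indicator {\<sigma><..\<tau>} u *\<^sub>R a u) \<partial>lborel)"
    by (rule nn_integral_cong) (auto simp: indicator_def)
  also have "\<dots> = ennreal (LINT u:{\<sigma><..\<tau>}|lborel. a u)"
    unfolding set_lebesgue_integral_def
    using a_integrable_Ioc[of \<sigma> \<tau>] a_nonneg
    by (intro nn_integral_eq_integral) (auto simp: set_integrable_def)
  finally show ?thesis using cum_diff[OF assms] by simp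
qed

text \<open>Both sides integrate \<open>h\<close>, against the law of the hitting time and against
  the expected hazard spent before the hit. It suffices to compare the two measures on half lines
  \<open>{\<tau><..}\<close>. With \<open>b\<close> the hazard spent between \<sigma> and the later
  of \<sigma> and \<tau>, the first gives P(v > b) and the second E max(0, v - b).\<close>

lemma hit_compensator:
  assumes h[measurable]: "h \<in> borel_measurable borel" and \<sigma>: "0 \<le> \<sigma>"
  shows "(\<integral>\<^sup>+v. h (hit \<sigma> v) \<partial>unit_exp) =
    (\<integral>\<^sup>+v. (\<integral>\<^sup>+u. h u * ennreal (a u) * indicator {\<sigma><..hit \<sigma> v} u \<partial>lborel) \<partial>unit_exp)"
proof -
  interpret E: prob_space unit_exp by (rule prob_space_exponential_density) simp
  interpret pair_sigma_finite lborel unit_exp ..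
  have [measurable]: "(\<lambda>(u, v). indicator {\<sigma><..hit \<sigma> v} u :: ennreal) \<in> borel_measurable (borel \<Otimes>\<^sub>M borel)"
  proof -
    have "(\<lambda>(u, v). indicator {\<sigma><..hit \<sigma> v} u :: ennreal) = indicator {p. \<sigma> < fst p \<and> fst p \<le> hit \<sigma> (snd p)}"
      by (auto simp: indicator_def fun_eq_iff)
    then show ?thesis by simp
  qed
  \<comment> \<open>The probability that \<open>u\<close> lies after \<sigma> but not after the hit;
    Fubini makes it the density factor of the second measure.\<close>
  define q where "q u = (\<integral>\<^sup>+v. indicator {\<sigma><..hit \<sigma> v} u \<partial>unit_exp)" for u
  have [measurable]: "q \<in> borel_measurable borel" unfolding q_def by measurable
  let ?\<mu> = "distr unit_exp borel (hit \<sigma>)" and ?\<nu> = "density lborel (\<lambda>u. ennreal (a u) * q u)"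
  have fubini: "(\<integral>\<^sup>+v. (\<integral>\<^sup>+u. g u * ennreal (a u) * indicator {\<sigma><..hit \<sigma> v} u \<partial>lborel) \<partial>unit_exp)
      = (\<integral>\<^sup>+u. g u \<partial>?\<nu>)" if [measurable]: "g \<in> borel_measurable borel" for g :: "real \<Rightarrow> ennreal"
  proof -
    have "(\<integral>\<^sup>+v. (\<integral>\<^sup>+u. g u * ennreal (a u) * indicator {\<sigma><..hit \<sigma> v} u \<partial>lborel) \<partial>unit_exp)
      = (\<integral>\<^sup>+u. (\<integral>\<^sup>+v. g u * ennreal (a u) * indicator {\<sigma><..hit \<sigma> v} u \<partial>unit_exp) \<partial>lborel)"
      by (rule Fubini') measurable
    also have "\<dots> = (\<integral>\<^sup>+u. ennreal (a u) * q u * g u \<partial>lborel)"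
      unfolding q_def by (intro nn_integral_cong, subst nn_integral_cmult) (auto simp: mult_ac)
    also have "\<dots> = (\<integral>\<^sup>+u. g u \<partial>?\<nu>)" by (rule nn_integral_density[symmetric]) measurable
    finally show ?thesis .
  qed
  have "?\<mu> = ?\<nu>"
  proof (rule measure_eqI_lessThan)
    fix \<tau> :: real
    show "emeasure ?\<mu> {\<tau><..} < \<infinity>"
      by (subst emeasure_distr) (auto simp: E.emeasure_eq_measure)
    define b where "b = cum (max \<tau> \<sigma>) - cum \<sigma>"
    have b: "0 \<le> b" using cum_bounds(1)[of \<sigma> "max \<tau> \<sigma>"] by (simp add: b_def)
    have "emeasure ?\<mu> {\<tau><..} = emeasure unit_exp {v. \<tau> < hit \<sigma> v}"
      by (subst emeasure_distr) (auto simp: vimage_def)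
    also have "\<dots> = emeasure unit_exp {b<..}"
    proof (rule emeasure_eq_AE)
      show "AE v in unit_exp. v \<in> {v. \<tau> < hit \<sigma> v} \<longleftrightarrow> v \<in> {b<..}"
        using unit_exp_AE_pos
      proof eventually_elim
        case (elim v)
        show ?case
        proof (cases "\<sigma> \<le> \<tau>")
          case True
          then have "hit \<sigma> v \<le> \<tau> \<longleftrightarrow> v \<le> b" by (auto simp: hit_le_iff b_def)
          then show ?thesis by auto
        next
          case False
          then show ?thesis using elim hit_ge[of \<sigma> v] by (auto simp: b_def)
        qed
      qed
      have "{v. \<tau> < hit \<sigma> v} \<in> sets borel" by measurable
      then show "{v. \<tau> < hit \<sigma> v} \<in> sets unit_exp" by simp
    qed simp
    also have "\<dots> = (\<integral>\<^sup>+v. ennreal (max 0 (v - b)) \<partial>unit_exp)"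
      using b by (simp only: unit_exp_tail unit_exp_excess)
    also have "\<dots> = (\<integral>\<^sup>+v. (\<integral>\<^sup>+u. indicator {\<tau><..} u * ennreal (a u) * indicator {\<sigma><..hit \<sigma> v} u \<partial>lborel) \<partial>unit_exp)"
    proof (rule nn_integral_cong_AE)
      show "AE v in unit_exp. ennreal (max 0 (v - b)) =
        (\<integral>\<^sup>+u. indicator {\<tau><..} u * ennreal (a u) * indicator {\<sigma><..hit \<sigma> v} u \<partial>lborel)"
        using unit_exp_AE_pos
      proof eventually_elim
        case (elim v)
        let ?m = "max \<tau> \<sigma>"
        have "(\<integral>\<^sup>+u. indicator {\<tau><..} u * ennreal (a u) * indicator {\<sigma><..hit \<sigma> v} u \<partial>lborel)
          = (\<integral>\<^sup>+u. ennreal (a u) * indicator {?m<..hit \<sigma> v} u \<partial>lborel)"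
          by (rule nn_integral_cong) (auto simp: indicator_def)
        \<comment> \<open>The hazard spent from \<sigma> to the hit is exactly \<open>v\<close>, of
          which \<open>b\<close> is spent by time \<open>?m\<close> when the hit comes
          later.\<close>
        also have "\<dots> = ennreal (max 0 (v - b))"
        proof (cases "?m \<le> hit \<sigma> v")
          case True
          then have "0 \<le> v - b" using cum_bounds(1)[OF True] cum_hit[of v \<sigma>] elim by (simp add: b_def)
          then show ?thesis using nn_integral_a[OF _ True] \<sigma> elim cum_hit[of v \<sigma>] by (simp add: b_def algebra_simps)
        next
          case False
          then have "cum (hit \<sigma> v) \<le> cum ?m" by (intro cum_bounds) auto
          then have "v - b \<le> 0" using elim cum_hit[of v \<sigma>] by (simp add: b_def)
          then show ?thesis using False by (simp add: max_def)
        qed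
        finally show ?case by simp
      qed
    qed
    also have "\<dots> = emeasure ?\<nu> {\<tau><..}" by (subst fubini) auto
    finally show "emeasure ?\<mu> {\<tau><..} = emeasure ?\<nu> {\<tau><..}" .
  qed auto
  then have "(\<integral>\<^sup>+u. h u \<partial>?\<mu>) = (\<integral>\<^sup>+u. h u \<partial>?\<nu>)" by simp
  moreover have "(\<integral>\<^sup>+u. h u \<partial>?\<mu>) = (\<integral>\<^sup>+v. h (hit \<sigma> v) \<partial>unit_exp)" by (rule nn_integral_distr) auto
  ultimately show ?thesis by (simp add: fubini)
qed

end

section \<open>Jump processes from exponential variables\<close>

abbreviation exp_seq :: "(nat \<Rightarrow> real) measure" where
  "exp_seq \<equiv> PiM UNIV (\<lambda>_. unit_exp)"

lemma prob_space_unit_exp: "prob_space unit_exp"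
  by (rule prob_space_exponential_density) simp

lemma space_exp_seq [simp]: "space exp_seq = UNIV"
  by (simp add: space_PiM)

lemma exp_seq_component [measurable]: "(\<lambda>e. e n) \<in> borel_measurable exp_seq"
  using measurable_component_singleton[of n UNIV "\<lambda>_. unit_exp"] by simp

lemma exp_seq_update [measurable]: "(\<lambda>(v, e). e(n := v)) \<in> unit_exp \<Otimes>\<^sub>M exp_seq \<rightarrow>\<^sub>M exp_seq"
  using measurable_add_dim[of n UNIV "\<lambda>_. unit_exp"] measurable_fun_upd[of UNIV UNIV n "\<lambda>p. snd p" "unit_exp \<Otimes>\<^sub>M exp_seq" "\<lambda>_. unit_exp" fst]
  by (simp add: case_prod_beta')

text \<open>Independence in the form needed here: redrawing coordinate \<open>n\<close> does not
  change the product law. All other coordinates can then be frozen without conditional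
  expectations.\<close>

lemma exp_seq_resample:
  assumes [measurable]: "\<phi> \<in> borel_measurable exp_seq"
  shows "(\<integral>\<^sup>+e. \<phi> e \<partial>exp_seq) = (\<integral>\<^sup>+e. (\<integral>\<^sup>+v. \<phi> (e(n := v)) \<partial>unit_exp) \<partial>exp_seq)"
proof -
  interpret E: prob_space unit_exp by (rule prob_space_unit_exp)
  interpret P: prob_space exp_seq by (intro prob_space_PiM prob_space_unit_exp)
  interpret pair_sigma_finite unit_exp exp_seq ..
  have "exp_seq = distr (unit_exp \<Otimes>\<^sub>M exp_seq) exp_seq (\<lambda>(v, e). e(n := v))"
    using distr_pair_PiM_eq_PiM[of UNIV "\<lambda>_. unit_exp" n] prob_space_unit_exp by simp
  then have "(\<integral>\<^sup>+e. \<phi> e \<partial>exp_seq) = (\<integral>\<^sup>+e. \<phi> e \<partial>distr (unit_exp \<Otimes>\<^sub>M exp_seq) exp_seq (\<lambda>(v, e). e(n := v)))"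
    by simp
  also have "\<dots> = (\<integral>\<^sup>+p. \<phi> (case p of (v, e) \<Rightarrow> e(n := v)) \<partial>(unit_exp \<Otimes>\<^sub>M exp_seq))"
    by (rule nn_integral_distr) auto
  also have "\<dots> = (\<integral>\<^sup>+e. (\<integral>\<^sup>+v. \<phi> (e(n := v)) \<partial>unit_exp) \<partial>exp_seq)"
    by (subst nn_integral_snd[symmetric]) auto
  finally show ?thesis .
qed

locale jump_construction =
  fixes \<xi> :: nat and a :: "nat \<Rightarrow> real \<Rightarrow> real" and K t :: real
  assumes rates: "\<And>n. hazard_rate (a n) K t"
begin

sublocale hz: hazard_rate "a n" K t for n by (rule rates)

lemma horizon: "0 \<le> t" by (rule hz.t)

text \<open>\<open>jump_at (Suc n)\<close> is the time of the jump out of level \<open>n\<close> and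
  depends on the coordinates up to \<open>n\<close> only. The recursion runs on past
  \<open>\<xi>\<close>; the cap is imposed by \<open>level\<close>.\<close>

fun jump_at :: "nat \<Rightarrow> (nat \<Rightarrow> real) \<Rightarrow> real" where
  "jump_at 0 e = 0"
| "jump_at (Suc n) e = hz.hit n (jump_at n e) (e n)"

lemma jump_at_cong: "(\<And>i. i < n \<Longrightarrow> e i = e' i) \<Longrightarrow> jump_at n e = jump_at n e'"
  by (induction n) auto

lemma jump_at_mono: "m \<le> n \<Longrightarrow> jump_at m e \<le> jump_at n e"
  by (rule lift_Suc_mono_le[of "\<lambda>n. jump_at n e"]) (simp_all add: hz.hit_ge)

lemma jump_at_nonneg: "0 \<le> jump_at n e"
  using jump_at_mono[of 0 n e] by simp

lemma jump_at_measurable [measurable]: "jump_at n \<in> borel_measurable exp_seq"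
proof (induction n)
  case (Suc n)
  note [measurable] = Suc.IH
  have "{e \<in> space exp_seq. jump_at n e \<le> \<tau> \<and> e n + hz.cum n (jump_at n e) \<le> hz.cum n \<tau>} \<in> sets exp_seq" for \<tau>
    by measurable
  then show ?case by (intro borel_measurableI_le) (simp add: hz.hit_le_iff)
qed simp

definition level :: "real \<Rightarrow> (nat \<Rightarrow> real) \<Rightarrow> nat" where
  "level \<tau> e = card {n. n < \<xi> \<and> jump_at (Suc n) e \<le> \<tau>}"

text \<open>Jump times increase with their index, so the indices counted by \<open>level\<close>
  form an initial segment of the naturals and the count determines the set.\<close>

lemma less_level_iff: "n < level \<tau> e \<longleftrightarrow> n < \<xi> \<and> jump_at (Suc n) e \<le> \<tau>"
proof -
  let ?S = "{n. n < \<xi> \<and> jump_at (Suc n) e \<le> \<tau>}"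
  have fin: "finite ?S" by simp
  then obtain m where m: "m \<notin> ?S" "\<And>i. i < m \<Longrightarrow> i \<in> ?S"
    using exists_least_iff[of "\<lambda>n. n \<notin> ?S"] ex_new_if_finite[OF infinite_UNIV_nat fin] by blast
  have "?S \<subseteq> {..<m}"
  proof
    fix i assume i: "i \<in> ?S"
    show "i \<in> {..<m}"
    proof (rule ccontr)
      assume "i \<notin> {..<m}"
      then have "m \<le> i" by simp
      then have "m \<in> ?S" using i jump_at_mono[of "Suc m" "Suc i" e] by (auto simp del: jump_at.simps)
      then show False using m by simp
    qed
  qed
  then have "?S = {..<m}" using m(2) by blast
  then have "?S = {..<level \<tau> e}" unfolding level_def by simp
  then show ?thesis by blast
qed

lemma level_le: "level \<tau> e \<le> \<xi>"
  using less_level_iff[of \<xi> \<tau> e] by (simp add: not_less[symmetric])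

lemma level_eqI:
  assumes "\<And>n. n < \<xi> \<Longrightarrow> jump_at (Suc n) e \<le> \<tau> \<longleftrightarrow> jump_at (Suc n) e' \<le> \<tau>'"
  shows "level \<tau> e = level \<tau>' e'"
proof -
  have "{n. n < \<xi> \<and> jump_at (Suc n) e \<le> \<tau>} = {n. n < \<xi> \<and> jump_at (Suc n) e' \<le> \<tau>'}" using assms by blast
  then show ?thesis by (simp add: level_def)
qed

lemma level_mono: "\<sigma> \<le> \<tau> \<Longrightarrow> level \<sigma> e \<le> level \<tau> e"
  unfolding level_def by (intro card_mono) auto

lemma level_measurable: "level \<tau> \<in> measurable exp_seq (count_space UNIV)"
proof -
  have "level \<tau> = (\<lambda>e. \<Sum>n<\<xi>. if jump_at (Suc n) e \<le> \<tau> then 1 else 0)"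
    by (auto simp: level_def fun_eq_iff sum.If_cases intro!: arg_cong[where f=card] simp del: jump_at.simps)
  moreover have "(\<lambda>e. \<Sum>n<\<xi>. if jump_at (Suc n) e \<le> \<tau> then 1 else (0::nat)) \<in> measurable exp_seq (count_space UNIV)"
    using jump_at_measurable by measurable
  ultimately show ?thesis by simp
qed

text \<open>
  Galmarino's test: the events known at time \<open>\<tau>\<close> are the ones saturated for this relation.
\<close>

definition same_history :: "real \<Rightarrow> (nat \<Rightarrow> real) \<Rightarrow> (nat \<Rightarrow> real) \<Rightarrow> bool" where
  "same_history \<tau> e e' \<longleftrightarrow> level \<tau> e = level \<tau> e' \<and> (\<forall>i<level \<tau> e. e i = e' i)"

definition known :: "real \<Rightarrow> (nat \<Rightarrow> real) set set" where
  "known \<tau> = {A \<in> sets exp_seq. \<forall>e e'. same_history \<tau> e e' \<longrightarrow> (e \<in> A \<longleftrightarrow> e' \<in> A)}"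

definition info :: "real \<Rightarrow> (nat \<Rightarrow> real) measure" where
  "info \<tau> = sigma UNIV (known \<tau>)"

text \<open>Jumps up to \<tau> are computed from shared coordinates and coincide; all others come
  after \<tau> in both sequences and thus do not count at \<sigma>. This makes \<open>info\<close>
  increasing in time.\<close>

lemma same_history_mono:
  assumes "\<sigma> \<le> \<tau>" "same_history \<tau> e e'" shows "same_history \<sigma> e e'"
proof -
  have eq: "level \<tau> e = level \<tau> e'" "\<And>i. i < level \<tau> e \<Longrightarrow> e i = e' i"
    using assms(2) by (auto simp: same_history_def)
  have "level \<sigma> e = level \<sigma> e'"
  proof (rule level_eqI)
    fix n assume n: "n < \<xi>"
    show "jump_at (Suc n) e \<le> \<sigma> \<longleftrightarrow> jump_at (Suc n) e' \<le> \<sigma>"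
    proof (cases "n < level \<tau> e")
      case True
      then have "jump_at (Suc n) e = jump_at (Suc n) e'" using eq(2) by (intro jump_at_cong) auto
      then show ?thesis by simp
    next
      case False
      then have "\<tau> < jump_at (Suc n) e" "\<tau> < jump_at (Suc n) e'"
        using n eq(1) less_level_iff[of n \<tau> e] less_level_iff[of n \<tau> e'] by auto
      then show ?thesis using assms(1) by auto
    qed
  qed
  then show ?thesis using eq level_mono[OF assms(1), of e] by (auto simp: same_history_def)
qed

lemma sets_info: "sets (info \<tau>) = known \<tau>"
proof -
  have "sigma_algebra UNIV (known \<tau>)"
    unfolding sigma_algebra_iff2
  proof (intro conjI ballI allI impI)
    show "known \<tau> \<subseteq> Pow UNIV" "{} \<in> known \<tau>" by (auto simp: known_def)
    show "UNIV - A \<in> known \<tau>" if "A \<in> known \<tau>" for A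
      using that sets.compl_sets[of A exp_seq] by (auto simp: known_def)
    show "(\<Union>i::nat. A i) \<in> known \<tau>" if "range A \<subseteq> known \<tau>" for A
      using that unfolding known_def by (auto intro!: sets.countable_UN)
  qed
  then show ?thesis unfolding info_def by (rule sigma_algebra.sets_measure_of_eq)
qed

lemma space_info: "space (info \<tau>) = UNIV"
  unfolding info_def by (rule space_measure_of) simp

lemma info_measurableI:
  assumes f: "f \<in> measurable exp_seq N" and sat: "\<And>e e'. same_history \<tau> e e' \<Longrightarrow> f e = f e'"
  shows "f \<in> measurable (info \<tau>) N"
proof (rule measurableI)
  fix A assume "A \<in> sets N"
  then have "f -` A \<in> sets exp_seq" using measurable_sets[OF f] by force
  then show "f -` A \<inter> space (info \<tau>) \<in> sets (info \<tau>)"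
    using sat unfolding sets_info known_def space_info by auto
qed (use measurable_space[OF f] in auto)

sublocale subfiltration exp_seq info t
proof
  show "space (info i) = space exp_seq" for i by (simp add: space_info)
  show "sets (info i) \<le> sets (info j)" if "i \<le> j" for i j
    using same_history_mono[OF that] unfolding sets_info known_def by blast
  show "sets (info \<tau>) \<subseteq> sets exp_seq" for \<tau> by (auto simp: sets_info known_def)
qed (rule horizon)

lemma level_adapted: "level \<tau> \<in> measurable (info \<tau>) (count_space UNIV)"
  by (rule info_measurableI[OF level_measurable]) (simp add: same_history_def)

text \<open>Up to and including the jump out of level \<open>n\<close>, a predictable set sees only
  the coordinates below \<open>n\<close>. For a generator \<open>{p<..q} \<times> A\<close> with
  \<open>p < \<tau>\<close> that jump lies strictly after \<open>p\<close>, so both sequences have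
  the same history at \<open>p\<close>; complements and unions preserve the property.\<close>

lemma predictable_section:
  assumes Z: "Z \<in> sets pred_sigma" and n: "n < \<xi>" "\<And>i. i < n \<Longrightarrow> e i = e' i"
    and \<tau>: "0 < \<tau>" "\<tau> \<le> t" "\<tau> \<le> jump_at (Suc n) e" "\<tau> \<le> jump_at (Suc n) e'"
  shows "(\<tau>, e) \<in> Z \<longleftrightarrow> (\<tau>, e') \<in> Z"
  using Z unfolding sets_predictable
proof (induction Z)
  case (Basic Z)
  then consider A where "Z = {0} \<times> A" | p q A where "Z = {p<..q} \<times> A" "A \<in> sets (info p)" by blast
  then show ?case
  proof cases
    case 1 then show ?thesis using \<tau> by simp
  next
    case 2
    have "same_history p e e'" if "p < \<tau>"
    proof -
      have late: "p < jump_at (Suc k) e" "p < jump_at (Suc k) e'" if "n \<le> k" for k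
        using \<tau> \<open>p < \<tau>\<close> that jump_at_mono[of "Suc n" "Suc k" e] jump_at_mono[of "Suc n" "Suc k" e'] by auto
      have "level p e = level p e'"
      proof (rule level_eqI)
        fix k
        show "jump_at (Suc k) e \<le> p \<longleftrightarrow> jump_at (Suc k) e' \<le> p"
        proof (cases "n \<le> k")
          case True then show ?thesis using late[OF True] by simp
        next
          case False
          then have "jump_at (Suc k) e = jump_at (Suc k) e'" using n(2) by (intro jump_at_cong) auto
          then show ?thesis by simp
        qed
      qed
      moreover have "\<not> n < level p e" using late[of n] by (simp add: less_level_iff del: jump_at.simps)
      ultimately show ?thesis using n(2) by (auto simp: same_history_def)
    qed
    then show ?thesis using 2 by (auto simp: sets_info known_def)
  qed
next
  case (Compl Z) then show ?case using \<tau> by auto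
qed auto

lemma predictable_function_section:
  fixes C :: "real \<times> (nat \<Rightarrow> real) \<Rightarrow> ennreal"
  assumes C: "C \<in> borel_measurable pred_sigma" and n: "n < \<xi>" "\<And>i. i < n \<Longrightarrow> e i = e' i"
    and \<tau>: "0 < \<tau>" "\<tau> \<le> t" "\<tau> \<le> jump_at (Suc n) e" "\<tau> \<le> jump_at (Suc n) e'"
  shows "C (\<tau>, e) = C (\<tau>, e')"
proof -
  have "C -` {C (\<tau>, e)} \<inter> space pred_sigma \<in> sets pred_sigma" by (rule measurable_sets[OF C]) simp
  from predictable_section[OF this n \<tau>, unfolded space_predictable] \<tau> show ?thesis by auto
qed

end

context jump_construction
begin

section \<open>Paths of the constructed level\<close>

lemma level_eq_iff:
  assumes "0 \<le> \<tau>"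
  shows "level \<tau> e = n \<longleftrightarrow> n \<le> \<xi> \<and> jump_at n e \<le> \<tau> \<and> (n < \<xi> \<longrightarrow> \<tau> < jump_at (Suc n) e)"
proof -
  have "n \<le> level \<tau> e \<longleftrightarrow> n \<le> \<xi> \<and> jump_at n e \<le> \<tau>"
    using assms by (cases n) (auto simp: Suc_le_eq less_level_iff simp del: jump_at.simps(2))
  moreover have "level \<tau> e \<le> n \<longleftrightarrow> (n < \<xi> \<longrightarrow> \<tau> < jump_at (Suc n) e)"
    using less_level_iff[of n \<tau> e] by auto
  ultimately show ?thesis by (metis antisym order_refl)
qed

lemma level_right_continuous:
  assumes "0 \<le> \<tau>" shows "continuous (at_right \<tau>) (\<lambda>\<tau>. level \<tau> e)"
proof -
  have "\<exists>b>\<tau>. \<forall>u>\<tau>. u < b \<longrightarrow> level u e = level \<tau> e"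
  proof (cases "level \<tau> e < \<xi>")
    case True
    define n where "n = level \<tau> e"
    have n: "n < \<xi>" "jump_at n e \<le> \<tau>" "\<tau> < jump_at (Suc n) e"
      using level_eq_iff[OF assms, of e n] True by (auto simp: n_def)
    show ?thesis
    proof (intro exI[of _ "jump_at (Suc n) e"] conjI allI impI)
      fix u assume "\<tau> < u" "u < jump_at (Suc n) e"
      then show "level u e = level \<tau> e"
        using n assms level_eq_iff[of u e n] by (simp add: n_def)
    qed fact
  next
    case False
    then have "level \<tau> e = \<xi>" using level_le[of \<tau> e] by simp
    then have "level u e = level \<tau> e" if "\<tau> < u" for u
      using level_mono[of \<tau> u e] level_le[of u e] that by simp
    then show ?thesis by (intro exI[of _ "\<tau> + 1"]) auto
  qed
  then show ?thesis
    by (auto simp: continuous_within tendsto_discrete eventually_at_right[of \<tau> "\<tau> + 1"])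
qed

context
  fixes e :: "nat \<Rightarrow> real"
  assumes pos: "\<And>i. 0 < e i"
begin

lemma jump_at_strict: "jump_at n e < jump_at (Suc n) e"
  by (simp add: hz.hit_gt pos)

text \<open>Positive exponentials give distinct jump times, so the level just before \<tau> is one
  lower if the present level is entered at \<tau>, and the same otherwise. At level 0 the
  subtraction cannot occur, since its entry time 0 lies before \<tau>.\<close>

lemma level_left_limit:
  assumes \<tau>: "0 < \<tau>"
  defines "m \<equiv> level \<tau> e"
  shows "((\<lambda>\<tau>. level \<tau> e) \<longlongrightarrow> (if jump_at m e = \<tau> then m - 1 else m)) (at_left \<tau>)"
proof -
  have m: "m \<le> \<xi>" "jump_at m e \<le> \<tau>" "m < \<xi> \<Longrightarrow> \<tau> < jump_at (Suc m) e"
    using level_eq_iff[of \<tau> e m] \<tau> by (auto simp: m_def)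
  show ?thesis
  proof (cases "jump_at m e = \<tau>")
    case True
    then obtain k where k: "m = Suc k" using \<tau> by (cases m) auto
    have "level u e = k" if "jump_at k e < u" "u < \<tau>" for u
      using level_eq_iff[of u e k] that m True jump_at_nonneg[of k e] by (simp add: k del: jump_at.simps)
    moreover have "jump_at k e < \<tau>" using jump_at_strict[of k] True by (simp add: k del: jump_at.simps)
    ultimately show ?thesis
      unfolding eventually_at_left_nat_const[OF \<tau>] using True jump_at_nonneg[of k e] k by auto
  next
    case False
    have "level u e = m" if "jump_at m e < u" "u < \<tau>" for u
      using level_eq_iff[of u e m] that m jump_at_nonneg[of m e] by (auto simp del: jump_at.simps)
    then show ?thesis
      unfolding eventually_at_left_nat_const[OF \<tau>] using m False jump_at_nonneg[of m e]
      by (intro exI[of _ "jump_at m e"]) auto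
  qed
qed

lemma level_unit_jump_path: "unit_jump_path t (\<lambda>\<tau>. level \<tau> e)"
  unfolding unit_jump_path_def
proof (intro conjI ballI)
  show "mono_on {0..t} (\<lambda>\<tau>. level \<tau> e)" by (intro mono_onI level_mono)
  show "continuous (at_right \<tau>) (\<lambda>\<tau>. level \<tau> e)" if "\<tau> \<in> {0..<t}" for \<tau>
    using that by (intro level_right_continuous) auto
  show "\<exists>l. ((\<lambda>\<tau>. level \<tau> e) \<longlongrightarrow> l) (at_left \<tau>) \<and> (level \<tau> e = l \<or> level \<tau> e = l + 1)"
    if "\<tau> \<in> {0<..t}" for \<tau>
  proof (intro exI conjI)
    show "((\<lambda>\<tau>. level \<tau> e) \<longlongrightarrow> (if jump_at (level \<tau> e) e = \<tau> then level \<tau> e - 1 else level \<tau> e)) (at_left \<tau>)"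
      using that by (intro level_left_limit) auto
  qed auto
qed

lemma level_jump_times:
  "jump_times t (\<lambda>\<tau>. level \<tau> e) = (\<lambda>n. jump_at (Suc n) e) ` {n. n < \<xi> \<and> jump_at (Suc n) e \<le> t}"
proof (rule set_eqI)
  fix \<tau>
  show "\<tau> \<in> jump_times t (\<lambda>\<tau>. level \<tau> e) \<longleftrightarrow> \<tau> \<in> (\<lambda>n. jump_at (Suc n) e) ` {n. n < \<xi> \<and> jump_at (Suc n) e \<le> t}"
  proof (cases "0 < \<tau> \<and> \<tau> \<le> t")
    case True
    define m where "m = level \<tau> e"
    have m: "m \<le> \<xi>" using level_le by (simp add: m_def)
    have lim: "((\<lambda>\<tau>. level \<tau> e) \<longlongrightarrow> l) (at_left \<tau>) \<longleftrightarrow> l = (if jump_at m e = \<tau> then m - 1 else m)" for l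
      using level_left_limit[of \<tau>] True tendsto_unique[OF trivial_limit_at_left_real]
      unfolding m_def by blast
    have "\<tau> \<in> jump_times t (\<lambda>\<tau>. level \<tau> e) \<longleftrightarrow> jump_at m e = \<tau> \<and> 0 < m"
      using True unfolding mem_jump_times_iff lim m_def[symmetric] by auto
    also have "\<dots> \<longleftrightarrow> (\<exists>n<\<xi>. jump_at (Suc n) e = \<tau>)"
    proof
      assume "jump_at m e = \<tau> \<and> 0 < m"
      then show "\<exists>n<\<xi>. jump_at (Suc n) e = \<tau>" using m by (intro exI[of _ "m - 1"]) auto
    next
      assume "\<exists>n<\<xi>. jump_at (Suc n) e = \<tau>"
      then obtain n where n: "n < \<xi>" "jump_at (Suc n) e = \<tau>" by blast
      then have "level \<tau> e = Suc n" using True jump_at_strict[of "Suc n"] by (subst level_eq_iff) auto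
      then show "jump_at m e = \<tau> \<and> 0 < m" using n by (simp add: m_def)
    qed
    finally show ?thesis using True by auto
  next
    case False
    moreover have "0 < jump_at (Suc n) e" for n
      using jump_at_strict[of n] jump_at_nonneg[of n e] by linarith
    ultimately show ?thesis by (auto simp: mem_jump_times_iff simp del: jump_at.simps)
  qed
qed

text \<open>Replaces the random set of jump times by a fixed index range, so that expectations can
  be taken term by term.\<close>

lemma sum_level_jumps:
  fixes C :: "real \<Rightarrow> ennreal"
  shows "(\<Sum>\<tau>\<in>jump_times t (\<lambda>\<tau>. level \<tau> e). C \<tau>) =
    (\<Sum>n<\<xi>. C (jump_at (Suc n) e) * indicator {0..t} (jump_at (Suc n) e))"
proof -
  have "strict_mono (\<lambda>n. jump_at n e)" using jump_at_strict by (rule strict_monoI_Suc)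
  then have inj: "inj (\<lambda>n. jump_at n e)" by (rule strict_mono_imp_inj_on)
  have "inj_on (\<lambda>n. jump_at (Suc n) e) A" for A
    using injD[OF inj, of "Suc _" "Suc _"] by (auto simp: inj_on_def simp del: jump_at.simps)
  then have "(\<Sum>\<tau>\<in>jump_times t (\<lambda>\<tau>. level \<tau> e). C \<tau>) = (\<Sum>n\<in>{n. n < \<xi> \<and> jump_at (Suc n) e \<le> t}. C (jump_at (Suc n) e))"
    unfolding level_jump_times by (subst sum.reindex) auto
  also have "\<dots> = (\<Sum>n<\<xi>. C (jump_at (Suc n) e) * indicator {0..t} (jump_at (Suc n) e))"
    using jump_at_nonneg[of "Suc _" e]
    by (intro sum.mono_neutral_cong_left) (auto simp del: jump_at.simps)
  finally show ?thesis .
qed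

end

lemma AE_pos: "AE e in exp_seq. \<forall>i. 0 < e i"
  unfolding AE_all_countable
  by (intro allI AE_PiM_component prob_space_unit_exp unit_exp_AE_pos) simp

lemma between_jumps_measurable [measurable]:
  "(\<lambda>(e, u). indicator {jump_at n e<..jump_at (Suc n) e} u :: ennreal) \<in> borel_measurable (exp_seq \<Otimes>\<^sub>M lborel)"
proof -
  have "(\<lambda>(e, u). indicator {jump_at n e<..jump_at (Suc n) e} u :: ennreal)
    = indicator {p \<in> space (exp_seq \<Otimes>\<^sub>M lborel). jump_at n (fst p) < snd p \<and> snd p \<le> jump_at (Suc n) (fst p)}"
    by (auto simp: indicator_def fun_eq_iff space_pair_measure simp del: jump_at.simps)
  also have "\<dots> \<in> borel_measurable (exp_seq \<Otimes>\<^sub>M lborel)"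
    using jump_at_measurable[of n] jump_at_measurable[of "Suc n"] by measurable
  finally show ?thesis .
qed

text \<open>Resample coordinate \<open>n\<close> and freeze the others: the entry time \<sigma> into
  level \<open>n\<close> is then fixed and the next jump is a hitting time. By
  \<open>predictable_function_section\<close> the integrand up to that jump does not depend on the
  resampled value, so it is a function of time alone and \<open>hit_compensator\<close>
  applies.\<close>

lemma jump_compensator:
  assumes C: "C \<in> borel_measurable pred_sigma" and n: "n < \<xi>"
  shows "(\<integral>\<^sup>+e. C (jump_at (Suc n) e, e) * indicator {0..t} (jump_at (Suc n) e) \<partial>exp_seq) =
    (\<integral>\<^sup>+e. (\<integral>\<^sup>+u. C (u, e) * indicator {0..t} u * ennreal (a n u) *
      indicator {jump_at n e<..jump_at (Suc n) e} u \<partial>lborel) \<partial>exp_seq)"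
proof -
  define D where "D p = C p * indicator ({0..t} \<times> UNIV) p" for p
  have D_eq: "C (u, e) * indicator {0..t} u = D (u, e)" for u e
    by (auto simp: D_def indicator_def)
  have D[measurable]: "D \<in> borel_measurable (borel \<Otimes>\<^sub>M exp_seq)"
    using predictable_joint_measurable[OF C] unfolding D_def space_exp_seq .
  have m1: "(\<lambda>e. D (jump_at (Suc n) e, e)) \<in> borel_measurable exp_seq"
    using jump_at_measurable[of "Suc n"] by measurable
  have m2: "(\<lambda>e. \<integral>\<^sup>+u. D (u, e) * ennreal (a n u) * indicator {jump_at n e<..jump_at (Suc n) e} u \<partial>lborel) \<in> borel_measurable exp_seq"
    by measurable
  have "(\<integral>\<^sup>+e. D (jump_at (Suc n) e, e) \<partial>exp_seq) =
      (\<integral>\<^sup>+e. (\<integral>\<^sup>+u. D (u, e) * ennreal (a n u) * indicator {jump_at n e<..jump_at (Suc n) e} u \<partial>lborel) \<partial>exp_seq)"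
    unfolding exp_seq_resample[OF m1, of n] exp_seq_resample[OF m2, of n]
  proof (rule nn_integral_cong)
    fix e :: "nat \<Rightarrow> real"
    define \<sigma> where "\<sigma> = jump_at n e"
    \<comment> \<open>A budget above \<open>K * t\<close> puts the next jump beyond the horizon, so
      this one value represents the integrand at all times up to \<open>t\<close>.\<close>
    define v0 where "v0 = K * t + 1"
    define h where "h u = D (u, e(n := v0)) * indicator {0<..} u" for u
    have \<sigma>: "0 \<le> \<sigma>" by (simp add: \<sigma>_def jump_at_nonneg)
    have j: "jump_at n (e(n := v)) = \<sigma>" "jump_at (Suc n) (e(n := v)) = hz.hit n \<sigma> v" for v
      using jump_at_cong[of n "e(n := v)" e] by (auto simp: \<sigma>_def)
    have h_eq: "D (u, e(n := v)) = h u" if u: "0 < u" "u \<le> hz.hit n \<sigma> v" for u v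
    proof (cases "u \<le> t")
      case True
      have "t < hz.hit n \<sigma> v0" using \<sigma> by (intro hz.hit_late) (auto simp: v0_def)
      then have "C (u, e(n := v)) = C (u, e(n := v0))"
        using u True n by (intro predictable_function_section[OF C n]) (auto simp: j simp del: jump_at.simps)
      then show ?thesis using u by (auto simp: D_def h_def indicator_def)
    qed (use u in \<open>simp add: D_def h_def\<close>)
    have h[measurable]: "h \<in> borel_measurable borel"
    proof -
      have "(\<lambda>u. (u, e(n := v0))) \<in> borel \<rightarrow>\<^sub>M borel \<Otimes>\<^sub>M exp_seq" by (rule measurable_Pair2') simp
      then have "(\<lambda>u. D (u, e(n := v0))) \<in> borel_measurable borel" by (rule measurable_compose[OF _ D])
      then show ?thesis unfolding h_def by measurable
    qed
    have "(\<integral>\<^sup>+v. D (jump_at (Suc n) (e(n := v)), e(n := v)) \<partial>unit_exp) = (\<integral>\<^sup>+v. h (hz.hit n \<sigma> v) \<partial>unit_exp)"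
    proof (rule nn_integral_cong_AE)
      show "AE v in unit_exp. D (jump_at (Suc n) (e(n := v)), e(n := v)) = h (hz.hit n \<sigma> v)"
        using unit_exp_AE_pos
      proof eventually_elim
        case (elim v)
        then have "0 < hz.hit n \<sigma> v" using hz.hit_gt[OF elim, of \<sigma> n] \<sigma> by linarith
        then show ?case unfolding j by (intro h_eq) auto
      qed
    qed
    also have "\<dots> = (\<integral>\<^sup>+v. (\<integral>\<^sup>+u. h u * ennreal (a n u) * indicator {\<sigma><..hz.hit n \<sigma> v} u \<partial>lborel) \<partial>unit_exp)"
      by (rule hz.hit_compensator[OF h \<sigma>])
    also have "\<dots> = (\<integral>\<^sup>+v. (\<integral>\<^sup>+u. D (u, e(n := v)) * ennreal (a n u) *
        indicator {jump_at n (e(n := v))<..jump_at (Suc n) (e(n := v))} u \<partial>lborel) \<partial>unit_exp)"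
      unfolding j using \<sigma> h_eq by (intro nn_integral_cong) (auto simp: indicator_def)
    finally show "(\<integral>\<^sup>+v. D (jump_at (Suc n) (e(n := v)), e(n := v)) \<partial>unit_exp) =
      (\<integral>\<^sup>+v. (\<integral>\<^sup>+u. D (u, e(n := v)) * ennreal (a n u) *
        indicator {jump_at n (e(n := v))<..jump_at (Suc n) (e(n := v))} u \<partial>lborel) \<partial>unit_exp)" .
  qed
  then show ?thesis unfolding D_eq .
qed

text \<open>At time \<open>b\<close> a jump time is known only if it does not exceed
  \<open>b\<close>. \<open>g\<close> replaces the others by \<open>b + 1\<close>, which no time in
  \<open>{0..b}\<close> reaches.\<close>

lemma level_gt_progressive:
  assumes b: "0 \<le> b"
  shows "{p \<in> space (restrict_space borel {0..b} \<Otimes>\<^sub>M info b). n < level (fst p) (snd p)}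
    \<in> sets (restrict_space borel {0..b} \<Otimes>\<^sub>M info b)"
proof (cases "n < \<xi>")
  case True
  define g where "g e = (if jump_at (Suc n) e \<le> b then jump_at (Suc n) e else b + 1)" for e
  have [measurable]: "g \<in> borel_measurable (info b)"
  proof (rule info_measurableI)
    show "g \<in> borel_measurable exp_seq"
      unfolding g_def using jump_at_measurable[of "Suc n"] by measurable
    fix e e' assume "same_history b e e'"
    then have lv: "level b e = level b e'" "\<And>i. i < level b e \<Longrightarrow> e i = e' i" by (auto simp: same_history_def)
    show "g e = g e'"
    proof (cases "n < level b e")
      case True
      then have "jump_at (Suc n) e = jump_at (Suc n) e'" using lv(2) by (intro jump_at_cong) auto
      then show ?thesis by (simp add: g_def del: jump_at.simps)
    next
      case False
      then show ?thesis using \<open>n < \<xi>\<close> lv(1) less_level_iff[of n b e] less_level_iff[of n b e']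
        by (simp add: g_def del: jump_at.simps)
    qed
  qed
  have [measurable]: "(\<lambda>p. fst p) \<in> restrict_space borel {0..b} \<Otimes>\<^sub>M info b \<rightarrow>\<^sub>M borel"
    by (rule measurable_compose[OF measurable_fst]) (simp add: measurable_restrict_space1)
  have "{p \<in> space (restrict_space borel {0..b} \<Otimes>\<^sub>M info b). n < level (fst p) (snd p)} =
      {p \<in> space (restrict_space borel {0..b} \<Otimes>\<^sub>M info b). g (snd p) \<le> fst p}"
    using True by (auto simp: space_pair_measure space_restrict_space less_level_iff g_def simp del: jump_at.simps)
  also have "\<dots> \<in> sets (restrict_space borel {0..b} \<Otimes>\<^sub>M info b)" by measurable
  finally show ?thesis .
next
  case False
  then have "{p \<in> space (restrict_space borel {0..b} \<Otimes>\<^sub>M info b). n < level (fst p) (snd p)} = {}"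
    by (simp add: less_level_iff)
  then show ?thesis by (simp only: sets.empty_sets)
qed

end

section \<open>Feedback rates and their intensity\<close>

locale feedback_construction = jump_construction \<xi> a K t for \<xi> a K t +
  fixes smax lam :: real and f :: "real \<Rightarrow> real" and pol :: "nat \<Rightarrow> real \<Rightarrow> real"
  assumes pol_measurable: "\<And>n. pol n \<in> borel_measurable borel"
    and pol_range: "\<And>n \<tau>. pol n \<tau> \<in> {0..smax}"
    and a_pol: "\<And>n \<tau>. n < \<xi> \<Longrightarrow> \<tau> \<in> {0..t} \<Longrightarrow> a n \<tau> = lam * f (pol n \<tau>)"
    and f_0: "f 0 = 0"
begin

definition rate :: "real \<Rightarrow> (nat \<Rightarrow> real) \<Rightarrow> real" where
  "rate \<tau> e = (if level \<tau> e < \<xi> then pol (level \<tau> e) \<tau> else 0)"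

lemma rate_progressive:
  assumes b: "b \<in> {0..t}"
  shows "(\<lambda>(\<tau>, e). rate \<tau> e) \<in> borel_measurable (restrict_space borel {0..b} \<Otimes>\<^sub>M info b)"
proof -
  let ?N = "restrict_space borel {0..b} \<Otimes>\<^sub>M info b"
  define Q where "Q n = {p \<in> space ?N. n \<le> level (fst p) (snd p)} - {p \<in> space ?N. n < level (fst p) (snd p)}" for n
  have ge: "{p \<in> space ?N. n \<le> level (fst p) (snd p)} \<in> sets ?N" for n
    using level_gt_progressive[of b "n - 1"] b by (cases n) (auto simp: Suc_le_eq)
  have Q[measurable]: "Q n \<in> sets ?N" for n
    unfolding Q_def using ge level_gt_progressive b by auto
  have pol[measurable]: "(\<lambda>p. pol n (fst p)) \<in> borel_measurable ?N" for n
    by (rule measurable_compose[OF measurable_fst])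
       (use pol_measurable in \<open>simp add: measurable_restrict_space1\<close>)
  have "(\<lambda>p. \<Sum>n<\<xi>. indicator (Q n) p * pol n (fst p)) \<in> borel_measurable ?N" by measurable
  moreover have "(\<Sum>n<\<xi>. indicator (Q n) p * pol n (fst p)) = (\<lambda>(\<tau>, e). rate \<tau> e) p" if "p \<in> space ?N" for p
  proof -
    have "(\<Sum>n<\<xi>. indicator (Q n) p * pol n (fst p)) = (\<Sum>n<\<xi>. if n = level (fst p) (snd p) then pol n (fst p) else 0)"
      using that by (intro sum.cong) (auto simp: Q_def indicator_def)
    then show ?thesis by (simp add: rate_def case_prod_beta')
  qed
  ultimately show ?thesis by (simp cong: measurable_cong)
qed

text \<open>Sum \<open>jump_compensator\<close> over the levels. The intervals between successive
  jumps tile the time spent below \<open>\<xi>\<close>, and on the tile of level \<open>n\<close>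
  the hazard \<open>a n\<close> is \<open>lam * f\<close> of the rate in force. At
  \<open>\<xi>\<close> no tile is left, which matches \<open>f 0 = 0\<close>.\<close>

lemma intensity:
  assumes C: "C \<in> borel_measurable pred_sigma"
  shows "(\<integral>\<^sup>+ e. (\<Sum>\<tau>\<in>jump_times t (\<lambda>\<tau>. level \<tau> e). C (\<tau>, e)) \<partial>exp_seq) =
    (\<integral>\<^sup>+ e. (\<integral>\<^sup>+ \<tau>\<in>{0..t}. C (\<tau>, e) * ennreal (lam * f (rate \<tau> e)) \<partial>lborel) \<partial>exp_seq)"
proof -
  define D where "D p = C p * indicator ({0..t} \<times> UNIV) p" for p
  have D_eq: "C (u, e) * indicator {0..t} u = D (u, e)" for u e
    by (auto simp: D_def indicator_def)
  have D[measurable]: "D \<in> borel_measurable (borel \<Otimes>\<^sub>M exp_seq)"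
    using predictable_joint_measurable[OF C] unfolding D_def space_exp_seq .
  have m1: "(\<lambda>e. D (jump_at (Suc n) e, e)) \<in> borel_measurable exp_seq" for n
    using jump_at_measurable[of "Suc n"] by measurable
  have m2: "(\<lambda>e. \<integral>\<^sup>+u. D (u, e) * ennreal (a n u) * indicator {jump_at n e<..jump_at (Suc n) e} u \<partial>lborel) \<in> borel_measurable exp_seq" for n
    by measurable
  have m3: "(\<lambda>u. D (u, e) * ennreal (a n u) * indicator {jump_at n e<..jump_at (Suc n) e} u) \<in> borel_measurable lborel" for n e
  proof -
    have "(\<lambda>u. (u, e)) \<in> borel \<rightarrow>\<^sub>M borel \<Otimes>\<^sub>M exp_seq" by (rule measurable_Pair2') simp
    from measurable_compose[OF this D] have "(\<lambda>u. D (u, e)) \<in> borel_measurable lborel" by simp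
    moreover have "(\<lambda>u. ennreal (a n u)) \<in> borel_measurable lborel"
      by (rule measurable_compose[OF _ measurable_ennreal]) (simp add: hz.a_measurable)
    ultimately show ?thesis by (intro borel_measurable_times_ennreal borel_measurable_indicator) auto
  qed
  have "(\<integral>\<^sup>+ e. (\<Sum>\<tau>\<in>jump_times t (\<lambda>\<tau>. level \<tau> e). C (\<tau>, e)) \<partial>exp_seq)
    = (\<integral>\<^sup>+ e. (\<Sum>n<\<xi>. D (jump_at (Suc n) e, e)) \<partial>exp_seq)"
  proof (rule nn_integral_cong_AE)
    show "AE e in exp_seq. (\<Sum>\<tau>\<in>jump_times t (\<lambda>\<tau>. level \<tau> e). C (\<tau>, e)) = (\<Sum>n<\<xi>. D (jump_at (Suc n) e, e))"
      using AE_pos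
    proof eventually_elim
      case (elim e)
      then show ?case using sum_level_jumps[of e "\<lambda>\<tau>. C (\<tau>, e)"] unfolding D_eq by blast
    qed
  qed
  also have "\<dots> = (\<Sum>n<\<xi>. \<integral>\<^sup>+ e. D (jump_at (Suc n) e, e) \<partial>exp_seq)"
    by (rule nn_integral_sum) (rule m1)
  also have "\<dots> = (\<Sum>n<\<xi>. \<integral>\<^sup>+e. (\<integral>\<^sup>+u. D (u, e) * ennreal (a n u) * indicator {jump_at n e<..jump_at (Suc n) e} u \<partial>lborel) \<partial>exp_seq)"
    using jump_compensator[OF C] unfolding D_eq by (intro sum.cong) auto
  also have "\<dots> = (\<integral>\<^sup>+e. (\<Sum>n<\<xi>. \<integral>\<^sup>+u. D (u, e) * ennreal (a n u) * indicator {jump_at n e<..jump_at (Suc n) e} u \<partial>lborel) \<partial>exp_seq)"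
    by (rule nn_integral_sum[symmetric]) (rule m2)
  also have "\<dots> = (\<integral>\<^sup>+ e. (\<integral>\<^sup>+ \<tau>\<in>{0..t}. C (\<tau>, e) * ennreal (lam * f (rate \<tau> e)) \<partial>lborel) \<partial>exp_seq)"
  proof (rule nn_integral_cong)
    fix e :: "nat \<Rightarrow> real"
    have "(\<Sum>n<\<xi>. \<integral>\<^sup>+u. D (u, e) * ennreal (a n u) * indicator {jump_at n e<..jump_at (Suc n) e} u \<partial>lborel)
      = (\<integral>\<^sup>+u. (\<Sum>n<\<xi>. D (u, e) * ennreal (a n u) * indicator {jump_at n e<..jump_at (Suc n) e} u) \<partial>lborel)"
      by (rule nn_integral_sum[symmetric]) (rule m3)
    also have "\<dots> = (\<integral>\<^sup>+ \<tau>\<in>{0..t}. C (\<tau>, e) * ennreal (lam * f (rate \<tau> e)) \<partial>lborel)"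
    proof (rule nn_integral_cong_AE)
      \<comment> \<open>The tiles contain their right end points whereas the level is right
        continuous; jump times are therefore left out.\<close>
      have "finite ((\<lambda>k. jump_at k e) ` {..\<xi>})" by simp
      then have "AE u in lborel. u \<notin> (\<lambda>k. jump_at k e) ` {..\<xi>}"
        by (intro AE_not_in countable_imp_null_set_lborel countable_finite)
      then show "AE u in lborel. (\<Sum>n<\<xi>. D (u, e) * ennreal (a n u) * indicator {jump_at n e<..jump_at (Suc n) e} u)
        = C (u, e) * ennreal (lam * f (rate u e)) * indicator {0..t} u"
      proof eventually_elim
        case (elim u)
        show ?case
        proof (cases "u \<in> {0..t}")
          case True
          have "u \<in> {jump_at n e<..jump_at (Suc n) e} \<longleftrightarrow> n = level u e" if "n < \<xi>" for n
          proof -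
            have "u \<noteq> jump_at n e" "u \<noteq> jump_at (Suc n) e" using elim that by (auto simp del: jump_at.simps)
            then show ?thesis using level_eq_iff[of u e n] True that by auto
          qed
          then have "(\<Sum>n<\<xi>. D (u, e) * ennreal (a n u) * indicator {jump_at n e<..jump_at (Suc n) e} u)
            = (\<Sum>n<\<xi>. if n = level u e then D (u, e) * ennreal (a n u) else 0)"
            by (intro sum.cong) (auto simp: indicator_def simp del: jump_at.simps)
          also have "\<dots> = C (u, e) * ennreal (lam * f (rate u e))"
            using True f_0 by (auto simp: rate_def a_pol D_def)
          finally show ?thesis using True by simp
        qed (simp add: D_def)
      qed
    qed
    finally show "(\<Sum>n<\<xi>. \<integral>\<^sup>+u. D (u, e) * ennreal (a n u) * indicator {jump_at n e<..jump_at (Suc n) e} u \<partial>lborel)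
      = (\<integral>\<^sup>+ \<tau>\<in>{0..t}. C (\<tau>, e) * ennreal (lam * f (rate \<tau> e)) \<partial>lborel)" .
  qed
  finally show ?thesis .
qed

theorem controlled_system: "controlled_system exp_seq info \<xi> smax f lam 0 t rate level"
proof (intro controlled_system.intro controlled_system_axioms.intro)
  show "prob_space exp_seq" by (intro prob_space_PiM prob_space_unit_exp)
  show "filtration (space exp_seq) info" by (rule filtration_axioms)
  show "subalgebra exp_seq (info \<tau>)" for \<tau> using sub by (auto simp: subalgebra_def space_info)
  have "0 \<le> smax" using pol_range[of 0 0] by auto
  then show "rate \<tau> e \<in> {0..smax}" for \<tau> e using pol_range by (simp add: rate_def)
  show "AE e in exp_seq. level 0 e = 0"
    using AE_pos
  proof eventually_elim
    case (elim e)
    then show ?case using jump_at_strict[of e 0] by (subst level_eq_iff) auto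
  qed
  show "AE e in exp_seq. unit_jump_path t (\<lambda>\<tau>. level \<tau> e)"
    using AE_pos
  proof eventually_elim
    case (elim e)
    then show ?case using level_unit_jump_path by blast
  qed
qed (use rate_progressive level_adapted intensity level_le in \<open>auto simp: rate_def\<close>)

end

section \<open>Concavity of the optimal profit\<close>

context deterioration_model
begin

lemma hjb_solution_subset:
  assumes "hjb_solution T V" "t \<le> T" shows "hjb_solution t V"
proof -
  have "(V x has_real_derivative value_rate V x k) (at k within {0..t})" if "x \<le> \<xi>" "k \<in> {0..t}" for x k
    by (rule has_field_derivative_subset[where s="{0..T}"]) (use assms that in \<open>auto simp: hjb_solution_def\<close>)
  then show ?thesis using assms(1) by (simp add: hjb_solution_def)
qed

lemma optimal_policy_exists:
  assumes t: "0 \<le> t" and V: "hjb_solution t V"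
  obtains M :: "(nat \<Rightarrow> real) measure" and F s X
  where "controlled_system M F \<xi> smax f lam 0 t s X" "expected_profit r c t M s X = V 0 t"
proof -
  \<comment> \<open>Remaining time, clamped so that \<open>V\<close> is evaluated only where it is
    known to be continuous.\<close>
  define k where "k \<tau> = t - max 0 (min t \<tau>)" for \<tau> :: real
  define pol where "pol n \<tau> = (if n < \<xi> then best_rate (V n (k \<tau>) - V (Suc n) (k \<tau>)) else 0)" for n \<tau>
  \<comment> \<open>The value 1 after the horizon is the one prescribed by
    \<open>hazard_rate\<close>; it accounts for the 1 in the bound
    \<open>max 1 (lam * f smax)\<close>.\<close>
  define a where "a n \<tau> = (if \<tau> \<le> t then lam * f (pol n \<tau>) else 1)" for n \<tau>
  have pol_range: "pol n \<tau> \<in> {0..smax}" for n \<tau>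
    using best_rate_in smax_pos by (auto simp: pol_def)
  have pol_meas[measurable]: "pol n \<in> borel_measurable borel" for n
  proof (cases "n < \<xi>")
    case True
    have "continuous_on UNIV (\<lambda>\<tau>. V m (k \<tau>))" if "m \<le> \<xi>" for m
      by (rule continuous_on_compose2[OF V_cont[OF t V that]])
         (use t in \<open>auto simp: k_def intro!: continuous_intros\<close>)
    then have "continuous_on UNIV (\<lambda>\<tau>. V n (k \<tau>) - V (Suc n) (k \<tau>))"
      using True by (intro continuous_on_diff) auto
    then have "(\<lambda>\<tau>. V n (k \<tau>) - V (Suc n) (k \<tau>)) \<in> borel_measurable borel"
      by (rule borel_measurable_continuous_onI)
    from measurable_compose[OF this best_rate_measurable] show ?thesis
      using True by (simp add: pol_def[abs_def])
  qed (simp add: pol_def[abs_def])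
  have "hazard_rate (a n) (max 1 (lam * f smax)) t" for n
  proof
    have "continuous_on UNIV (\<lambda>s. f (max 0 (min smax s)))"
      by (rule continuous_on_compose2[OF f_cont]) (use smax_pos in \<open>auto intro!: continuous_intros\<close>)
    then have [measurable]: "(\<lambda>s. f (max 0 (min smax s))) \<in> borel_measurable borel"
      by (rule borel_measurable_continuous_onI)
    have "(\<lambda>\<tau>. f (max 0 (min smax (pol n \<tau>)))) \<in> borel_measurable borel" by measurable
    moreover have "max 0 (min smax (pol n \<tau>)) = pol n \<tau>" for \<tau> using pol_range[of n \<tau>] by auto
    ultimately have [measurable]: "(\<lambda>\<tau>. f (pol n \<tau>)) \<in> borel_measurable borel" by simp
    show "a n \<in> borel_measurable borel" unfolding a_def[abs_def] by measurable
    show "0 \<le> a n \<tau>" "a n \<tau> \<le> max 1 (lam * f smax)" for \<tau>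
      using lam_nonneg f_nonneg[OF pol_range[of n \<tau>]] mult_left_mono[OF f_le[OF pol_range[of n \<tau>]] lam_nonneg]
      by (auto simp: a_def)
  qed (auto simp: a_def t)
  then interpret fc: feedback_construction \<xi> a "max 1 (lam * f smax)" t smax lam f pol
    by unfold_locales (auto simp: pol_range[unfolded atLeastAtMost_iff] a_def f_zero hazard_rate_def)
  have sys: "controlled_system exp_seq fc.info \<xi> smax f lam 0 t fc.rate fc.level"
    by (rule fc.controlled_system)
  then interpret cv: controlled_value \<xi> smax lam f r c exp_seq fc.info 0 t fc.rate fc.level V
    by (intro controlled_value.intro controlled_value_axioms.intro deterioration_model_axioms) (use t V in auto)
  have "expected_profit r c t exp_seq fc.rate fc.level = V 0 t"
    by (rule cv.expected_profit_optimal) (auto simp: fc.rate_def pol_def k_def)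
  with sys show ?thesis by (rule that)
qed

theorem optimal_profit_eq:
  assumes t: "0 \<le> t" "t \<le> T" and V: "hjb_solution T V"
  shows "optimal_profit \<xi> smax f r c lam 0 t = V 0 t"
proof -
  note Vt = hjb_solution_subset[OF V t(2)]
  show ?thesis
    unfolding optimal_profit_def
  proof (rule cSup_eq_maximum)
    show "V 0 t \<in> {expected_profit r c t M s X |(M :: (nat \<Rightarrow> real) measure) F s X.
        controlled_system M F \<xi> smax f lam 0 t s X}"
      using optimal_policy_exists[OF t(1) Vt] by (smt (verit) mem_Collect_eq)
    fix y assume "y \<in> {expected_profit r c t M s X |(M :: (nat \<Rightarrow> real) measure) F s X.
        controlled_system M F \<xi> smax f lam 0 t s X}"
    then obtain M :: "(nat \<Rightarrow> real) measure" and F s X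
      where y: "y = expected_profit r c t M s X" and sys: "controlled_system M F \<xi> smax f lam 0 t s X" by blast
    interpret cv: controlled_value \<xi> smax lam f r c M F 0 t s X V
      by (intro controlled_value.intro controlled_value_axioms.intro deterioration_model_axioms)
         (use t Vt sys in auto)
    show "y \<le> V 0 t" unfolding y by (rule cv.expected_profit_le)
  qed
qed

lemma optimal_profit_concave:
  assumes T: "0 < T" and S: "0 < S" and u: "0 \<le> u" "u \<le> 1"
  shows "(1 - u) * optimal_profit \<xi> smax f r c lam 0 T + u * optimal_profit \<xi> smax f r c lam 0 S
    \<le> optimal_profit \<xi> smax f r c lam 0 ((1 - u) * T + u * S)"
proof -
  \<comment> \<open>\<open>value_concave\<close> concerns the open interval, so its right end is
    placed beyond both horizons.\<close>
  define U where "U = max T S + 1"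
  obtain V where V: "hjb_solution U V" using hjb_solution_exists[of U] T by (auto simp: U_def)
  have "concave_on {0<..<U} (V 0)" using T by (intro value_concave[OF _ V]) (auto simp: U_def)
  from concave_onD[OF this u, of T S] have
    "(1 - u) * V 0 T + u * V 0 S \<le> V 0 ((1 - u) * T + u * S)" using T S by (simp add: U_def)
  moreover have "0 \<le> (1 - u) * T + u * S" using T S u by simp
  moreover have "(1 - u) * T + u * S \<le> U"
    using convex_bound_le[of T "max T S" S "1 - u" u] u by (simp add: U_def)
  ultimately show ?thesis using T S by (simp add: optimal_profit_eq[OF _ _ V] U_def)
qed

end

theorem theorem2:
  fixes \<xi> :: nat and smax lam T' :: real
    and f r :: "real \<Rightarrow> real" and c :: "nat \<Rightarrow> real" and g :: "real \<Rightarrow> real"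
  assumes smax_pos: "0 < smax"
    and lam_nonneg: "0 \<le> lam"
    and f_nonneg: "\<And>s. s \<in> {0..smax} \<Longrightarrow> 0 \<le> f s"
    and f_cont: "continuous_on {0..smax} f"
    and f_mono: "mono_on {0..smax} f"
    and f_zero: "f 0 = 0"
    and r_cont: "continuous_on {0..smax} r"
    and r_mono: "mono_on {0..smax} r"
    and r_zero: "r 0 \<le> 0"
    and c_nonneg: "\<And>x. x \<in> {0..\<xi>} \<Longrightarrow> 0 \<le> c x"
    and c_mono: "mono_on {0..\<xi>} c"
    and c_convex: "\<And>x. x + 2 \<le> \<xi> \<Longrightarrow> c (x + 1) - c x \<le> c (x + 2) - c (x + 1)"
    and g_def: "g = average_profit \<xi> smax f r c lam"
    and T'_pos: "0 < T'"
    and T'_strict_local_max: "\<exists>\<epsilon>>0. \<forall>T>0. T \<noteq> T' \<and> \<bar>T - T'\<bar> < \<epsilon> \<longrightarrow> g T < g T'"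
  shows "\<forall>T>0. T \<noteq> T' \<longrightarrow> g T < g T'"
proof (intro allI impI, rule ccontr)
  interpret deterioration_model \<xi> smax lam f r c
    by unfold_locales (fact assms)+
  define J where "J = optimal_profit \<xi> smax f r c lam 0"
  have J: "J T = T * g T" if "0 < T" for T
    using that by (simp add: J_def g_def average_profit_def)
  fix T assume T: "0 < T" "T \<noteq> T'" and neg: "\<not> g T < g T'"
  obtain \<epsilon> where \<epsilon>: "0 < \<epsilon>" "\<And>T. 0 < T \<Longrightarrow> T \<noteq> T' \<Longrightarrow> \<bar>T - T'\<bar> < \<epsilon> \<Longrightarrow> g T < g T'"
    using T'_strict_local_max by blast
  \<comment> \<open>Moves \<open>S\<close> from \<open>T'\<close> towards \<open>T\<close> by at
    most half of \<epsilon>; the cap 1 keeps \<open>S\<close> on the segment.\<close>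
  define u where "u = min 1 (\<epsilon> / (2 * \<bar>T - T'\<bar>))"
  have d: "0 < \<bar>T - T'\<bar>" using T by simp
  have u: "0 < u" "u \<le> 1" using d \<epsilon> by (auto simp: u_def)
  have "u * \<bar>T - T'\<bar> \<le> \<epsilon> / (2 * \<bar>T - T'\<bar>) * \<bar>T - T'\<bar>"
    unfolding u_def by (intro mult_right_mono) auto
  then have small: "u * \<bar>T - T'\<bar> < \<epsilon>" using d \<epsilon>(1) by (simp add: field_simps)
  define S where "S = (1 - u) * T' + u * T"
  have S: "0 < S" using T'_pos T u unfolding S_def
    by (intro add_nonneg_pos mult_nonneg_nonneg mult_pos_pos) auto
  have diff: "S - T' = u * (T - T')" by (simp add: S_def algebra_simps)
  then have "S \<noteq> T'" using u T by auto
  then have "g S < g T'" using \<epsilon>(2)[OF S] small u by (simp add: diff abs_mult)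
  \<comment> \<open>As \<open>J T = T * g T\<close>, the negated claim places the chord of
    \<open>J\<close> between \<open>T'\<close> and \<open>T\<close> on or above the ray of slope
    \<open>g T'\<close> from the origin; concavity places \<open>J S\<close> on or above the
    chord.\<close>
  moreover have "S * g T' \<le> S * g S"
  proof -
    have "S * g T' = (1 - u) * (T' * g T') + u * T * g T'" by (simp add: S_def algebra_simps)
    also have "\<dots> \<le> (1 - u) * (T' * g T') + u * T * g T"
      using neg u T by (intro add_left_mono mult_left_mono) auto
    also have "\<dots> = (1 - u) * J T' + u * J T" using T T'_pos by (simp add: J)
    also have "\<dots> \<le> J S" unfolding J_def S_def by (rule optimal_profit_concave) (use T T'_pos u in auto)
    also have "\<dots> = S * g S" using S by (rule J)
    finally show ?thesis .
  qed
  ultimately show False using S by (simp add: mult_le_cancel_left_pos)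
qed

end
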